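(* Let $d_n=n(n+1)(n+2)$, let $T(f)=f-\int_{\mathbb{S}^n}f\,d\sigma$ for $f\in C(\mathbb{S}^n)$, and let $\varPsi_0$ be the unitarily invariant norm on $C(\mathbb{S}^n)$ defined by $$\varPsi_0(f)=\big(\varPsi^4(f)+\varPsi_3^4(Tf)\big)^{1/4},\qquad f\in C(\mathbb{S}^n),$$ where $\varPsi(f)=\big(3d_n\lVert f\rVert_{L^4}^4+n\,d_n\lVert Tf\rVert_{L^4}^4\big)^{1/4}$ and $\varPsi_3(\cdot)=\sqrt{2n(n+1)}\,\lVert\cdot\rVert_{L^2}$. Then the weakly unitarily invariant norm $N_{\varPsi_0}$ on $M_n(\mathbb{C})$ induced by $\varPsi_0$ satisfies, for all $A\in M_n(\mathbb{C})$, $$N_{\varPsi_0}^4(A)=4\lVert A^2\rVert_F^2+2\lVert A\rVert_{(4)}^4+6\lVert A\rVert_F^4+\frac4n\,\Re\Big[\mathrm{tr}(A^2)\big[\mathrm{tr}A^\star\big]^2\Big]+|\mathrm{tr}(A^2)|^2+\frac{3n-2}{n^2}\,|\mathrm{tr}(A)|^4.$$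
   Context: $\mathbb{S}^n$ is the unit sphere of $\mathbb{C}^n$, $\sigma$ the normalized Euclidean surface measure on it, $C(\mathbb{S}^n)$ the space of continuous complex functions on $\mathbb{S}^n$, and $L^p=L^p(\mathbb{S}^n,\sigma)$. A norm $\Phi$ on $C(\mathbb{S}^n)$ is unitarily invariant if $\Phi(f)=\Phi(f\circ U)$ for all $f\in C(\mathbb{S}^n)$ and all unitary $U$. The norm on $M_n(\mathbb{C})$ induced by such a $\Phi$ is $A\mapsto\Phi(f_A)$, where $f_A(\xi)=\langle A\xi,\xi\rangle$ for $\xi\in\mathbb{S}^n$; it is weakly unitarily invariant, i.e. invariant under $A\mapsto UAU^\star$ for unitary $U$. Thus $N_{\varPsi_0}(A)=\varPsi_0(f_A)$. $\lVert\cdot\rVert_F$ is the Frobenius norm, $\lVert A\rVert_{(4)}=[\mathrm{tr}(|A|^4)]^{1/4}$ with $|A|=\sqrt{A^\star A}$ is the Schatten 4-norm, $A^\star$ is the conjugate transpose, $\Re$ the real part. *)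

theory Defs
  imports "HOL-Analysis.Analysis"
begin

section \<open>Surface measure on the unit sphere\<close>

text \<open>
  Surface measure through polar coordinates: in dimension \<open>d\<close>, Lebesgue
  measure is the product of \<open>r^(d-1) dr\<close> and surface measure, so a Borel set \<open>E\<close> of the sphere has
  surface measure \<open>d\<close> times the volume of the cone over \<open>E\<close> inside the punctured unit ball.
\<close>

definition sphere_surface :: "'a::euclidean_space measure" where
  "sphere_surface = scale_measure (of_nat DIM('a))
     (distr (restrict_space lborel (ball 0 1 - {0})) (restrict_space borel (sphere 0 1))
        (\<lambda>x. x /\<^sub>R norm x))"

definition sphere_measure :: "'a::euclidean_space measure" where
  "sphere_measure = uniform_measure sphere_surface (sphere 0 1)"

lemma space_sphere_measure [simp]: "space sphere_measure = sphere 0 1"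
  by (simp add: sphere_measure_def sphere_surface_def space_scale_measure space_restrict_space)

lemma sets_sphere_surface [simp]: "sets sphere_surface = sets (restrict_space borel (sphere 0 1))"
  by (simp add: sphere_surface_def)

lemma sets_sphere_measure [simp]: "sets sphere_measure = sets (restrict_space borel (sphere 0 1))"
  by (simp add: sphere_measure_def)

lemma measurable_radial_projection:
  "(\<lambda>x::'a::euclidean_space. x /\<^sub>R norm x)
     \<in> restrict_space lborel (ball 0 1 - {0}) \<rightarrow>\<^sub>M restrict_space borel (sphere 0 1)"
  by (rule measurable_restrict_space3) (auto simp: Pi_iff)

lemma emeasure_sphere_surface:
  fixes E :: "'a::euclidean_space set"
  assumes "E \<in> sets borel" "E \<subseteq> sphere 0 1"
  shows "emeasure sphere_surface E
           = of_nat DIM('a) * emeasure lborel {x \<in> ball 0 1 - {0}. x /\<^sub>R norm x \<in> E}"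
proof -
  have E: "E \<in> sets (restrict_space borel (sphere 0 1))"
    using assms by (simp add: sets_restrict_space_iff)
  have "(\<lambda>x. x /\<^sub>R norm x) -` E \<inter> (ball 0 1 - {0}) = {x \<in> ball 0 1 - {0}. x /\<^sub>R norm x \<in> E}"
    by auto
  moreover have "emeasure (restrict_space lborel (ball 0 1 - {0})) B = emeasure lborel B"
    if "B \<subseteq> ball 0 1 - {0}" for B :: "'a set"
    using that by (intro emeasure_restrict_space) auto
  ultimately show ?thesis
    using E
    by (simp add: sphere_surface_def emeasure_distr[OF measurable_radial_projection]
        space_restrict_space subset_iff)
qed

lemma emeasure_sphere_surface_total:
  "emeasure (sphere_surface :: 'a::euclidean_space measure) (sphere 0 1)
     = of_nat DIM('a) * emeasure lborel (ball (0::'a) 1)"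
proof -
  have "{x \<in> ball 0 1 - {0}. x /\<^sub>R norm x \<in> sphere 0 1} = ball (0::'a) 1 - {0}"
    by auto
  moreover have "emeasure lborel (ball (0::'a) 1 - {0}) = emeasure lborel (ball (0::'a) 1)"
    by (rule emeasure_Diff_null_set) (auto simp: null_sets_def)
  ultimately show ?thesis
    by (subst emeasure_sphere_surface) auto
qed

lemma emeasure_sphere_measure_total:
  "emeasure (sphere_measure :: 'a::euclidean_space measure) (sphere 0 1) = 1"
proof -
  have "emeasure lborel (ball (0::'a) 1) \<noteq> 0"
    using content_ball_pos[of 1 "0::'a"] by (auto simp: measure_def)
  moreover have "emeasure lborel (ball (0::'a) 1) \<noteq> \<infinity>"
    using emeasure_lborel_ball_finite[of "0::'a" 1] by auto
  ultimately show ?thesis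
    unfolding sphere_measure_def
    by (subst emeasure_uniform_measure_1)
       (simp_all add: emeasure_sphere_surface_total ennreal_mult_eq_top_iff)
qed

section \<open>Complex matrices\<close>

definition hinner :: "complex^'n \<Rightarrow> complex^'n \<Rightarrow> complex" where
  "hinner x y = (\<Sum>i\<in>UNIV. x $ i * cnj (y $ i))"

definition adj :: "complex^'n^'n \<Rightarrow> complex^'n^'n" where
  "adj A = (\<chi> i j. cnj (A $ j $ i))"

definition unitary_matrix :: "complex^'n^'n \<Rightarrow> bool" where
  "unitary_matrix U \<longleftrightarrow> adj U ** U = mat 1 \<and> U ** adj U = mat 1"

definition pos_semidef :: "complex^'n^'n \<Rightarrow> bool" where
  "pos_semidef P \<longleftrightarrow> adj P = P \<and> (\<forall>x. 0 \<le> Re (hinner (P *v x) x))"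

definition matrix_sqrt :: "complex^'n^'n \<Rightarrow> complex^'n^'n" where
  "matrix_sqrt B = (THE P. pos_semidef P \<and> P ** P = B)"

definition matrix_abs :: "complex^'n^'n \<Rightarrow> complex^'n^'n" where
  "matrix_abs A = matrix_sqrt (adj A ** A)"

definition frobenius_norm :: "complex^'n^'n \<Rightarrow> real" where
  "frobenius_norm A = sqrt (\<Sum>i\<in>UNIV. \<Sum>j\<in>UNIV. (cmod (A $ i $ j))\<^sup>2)"

definition schatten4_norm :: "complex^'n^'n \<Rightarrow> real" where
  "schatten4_norm A =
     (Re (trace (matrix_abs A ** matrix_abs A ** matrix_abs A ** matrix_abs A))) powr (1/4)"

section \<open>Invariant norms\<close>

text \<open>
  Elements of the space of continuous functions on the sphere are represented by functions on
  all of \<open>complex^'n\<close> that are continuous on the sphere.  The definiteness clause only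
  looks at the sphere; together with the triangle inequality it forces a norm to depend only
  on the restriction of its argument to the sphere.
\<close>

definition unitarily_invariant_norm :: "((complex^'n \<Rightarrow> complex) \<Rightarrow> real) \<Rightarrow> bool" where
  "unitarily_invariant_norm \<Phi> \<longleftrightarrow>
     (\<forall>f. continuous_on (sphere 0 1) f \<longrightarrow> 0 \<le> \<Phi> f) \<and>
     (\<forall>f. continuous_on (sphere 0 1) f \<longrightarrow> (\<Phi> f = 0 \<longleftrightarrow> (\<forall>\<xi>\<in>sphere 0 1. f \<xi> = 0))) \<and>
     (\<forall>c f. continuous_on (sphere 0 1) f \<longrightarrow> \<Phi> (\<lambda>\<xi>. c * f \<xi>) = cmod c * \<Phi> f) \<and>
     (\<forall>f g. continuous_on (sphere 0 1) f \<longrightarrow> continuous_on (sphere 0 1) g \<longrightarrow>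
        \<Phi> (\<lambda>\<xi>. f \<xi> + g \<xi>) \<le> \<Phi> f + \<Phi> g) \<and>
     (\<forall>f U. continuous_on (sphere 0 1) f \<longrightarrow> unitary_matrix U \<longrightarrow>
        \<Phi> (\<lambda>\<xi>. f (U *v \<xi>)) = \<Phi> f)"

definition weakly_unitarily_invariant_norm :: "(complex^'n^'n \<Rightarrow> real) \<Rightarrow> bool" where
  "weakly_unitarily_invariant_norm N \<longleftrightarrow>
     (\<forall>A. 0 \<le> N A) \<and>
     (\<forall>A. N A = 0 \<longleftrightarrow> A = 0) \<and>
     (\<forall>c A. N (\<chi> i j. c * A $ i $ j) = cmod c * N A) \<and>
     (\<forall>A B. N (A + B) \<le> N A + N B) \<and>
     (\<forall>A U. unitary_matrix U \<longrightarrow> N (U ** A ** adj U) = N A)"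

definition quadratic_form :: "complex^'n^'n \<Rightarrow> complex^'n \<Rightarrow> complex" where
  "quadratic_form A \<xi> = hinner (A *v \<xi>) \<xi>"

definition induced_norm :: "((complex^'n \<Rightarrow> complex) \<Rightarrow> real) \<Rightarrow> complex^'n^'n \<Rightarrow> real" where
  "induced_norm \<Phi> A = \<Phi> (quadratic_form A)"

section \<open>The norm \<open>\<Psi>\<^sub>0\<close>\<close>

definition Lp_norm :: "real \<Rightarrow> (complex^'n \<Rightarrow> complex) \<Rightarrow> real" where
  "Lp_norm p f = (LINT \<xi>|sphere_measure. cmod (f \<xi>) powr p) powr (1/p)"

definition centered :: "(complex^'n \<Rightarrow> complex) \<Rightarrow> complex^'n \<Rightarrow> complex" where
  "centered f = (\<lambda>\<xi>. f \<xi> - (LINT \<zeta>|sphere_measure. f \<zeta>))"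

definition d_coeff :: "nat \<Rightarrow> real" where
  "d_coeff n = real (n * (n + 1) * (n + 2))"

definition Psi :: "(complex^'n \<Rightarrow> complex) \<Rightarrow> real" where
  "Psi f = (3 * d_coeff CARD('n) * Lp_norm 4 f ^ 4
            + real CARD('n) * d_coeff CARD('n) * Lp_norm 4 (centered f) ^ 4) powr (1/4)"

definition Psi3 :: "(complex^'n \<Rightarrow> complex) \<Rightarrow> real" where
  "Psi3 f = sqrt (2 * real CARD('n) * (real CARD('n) + 1)) * Lp_norm 2 f"

definition Psi0 :: "(complex^'n \<Rightarrow> complex) \<Rightarrow> real" where
  "Psi0 f = (Psi f ^ 4 + Psi3 (centered f) ^ 4) powr (1/4)"

end

theory Submission
  imports Defs
begin

text \<open>
  The surface measure is invariant under the unitary group, so the mean of a polynomial in quadratic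
  forms has vanishing derivative along every one-parameter group of unitaries. By complex linearity
  the mean of the derivation \<open>f\<^sub>B \<mapsto> f\<^sub>[\<^sub>B\<^sub>,\<^sub>X\<^sub>]\<close> vanishes for all matrices \<open>X\<close>. Applied to
  \<open>f\<close> of \<open>A E\<^sub>q\<^sub>p\<close> times \<open>f\<^sub>B f\<^sub>C f\<^sub>D\<close> with \<open>X = E\<^sub>p\<^sub>q\<close>, and summed over \<open>p\<close> and \<open>q\<close>, this gives
  a recursion that writes the fourth moments as sums of products of traces. After the substitution
  \<open>A = B + a I\<close> with \<open>B\<close> traceless, the factor \<open>n + 3\<close> in their denominator cancels between the
  two fourth-moment terms of \<open>\<Psi>\<^sub>0\<close>. The Schatten norm enters through \<open>tr |A|\<^sup>4 = tr (A\<^sup>* A)\<^sup>2\<close>, for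
  which \<open>|A|\<close> is obtained as \<open>U A\<close> with \<open>U\<close> a unitary maximising \<open>Re tr (U A)\<close>.
\<close>

section \<open>The surface measure of the sphere\<close>

text \<open>Why \<open>n + 3\<close> disappears: on the sphere \<open>f_A = f_B + a\<close>, so the
  fourth moment of \<open>f_A\<close> is that of \<open>f_B\<close> plus terms built from moments of
  order at most three, whose denominators divide \<open>n(n+1)(n+2)\<close>. Only the pure fourth
  moment of \<open>f_B\<close> carries \<open>n + 3\<close>. It occurs with weight
  \<open>3 d_n\<close> through \<open>f\<close> and with weight \<open>n d_n\<close> through
  \<open>Tf\<close>, so its total weight is \<open>(n + 3) d_n\<close>. The obstacle on the analytic
  side is that unitary curves supply only skew-Hermitian directions, while the recursion needs
  matrix units. Skew-Hermitian \<open>H\<close> with \<open>H^3 = -H\<close> suffice: over the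
  complex numbers they span all matrices, and their exponentials are quadratic polynomials in
  \<open>H\<close>, so the curve can be written down and estimated by hand. The pair
  \<open>A E_qp\<close>, \<open>E_pq\<close> is summed because the two index sums contract
  coordinates of the same point \<open>z\<close>: products of two quadratic forms close up to
  \<open>f_A f_B\<close> and \<open>f_AB\<close>, and no new kind of integral arises.\<close>

lemma orthogonal_transformation_borel_measurable:
  fixes T :: "'a::euclidean_space \<Rightarrow> 'a"
  assumes "orthogonal_transformation T"
  shows "T \<in> borel_measurable borel"
  using assms
  by (intro borel_measurable_continuous_onI linear_continuous_on)
     (simp add: orthogonal_transformation_linear linear_conv_bounded_linear[symmetric])

lemma nn_integral_lborel_shift:
  fixes f :: "'a::euclidean_space \<Rightarrow> ennreal"
  assumes [measurable]: "f \<in> borel_measurable borel"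
  shows "(\<integral>\<^sup>+x. f (c + x) \<partial>lborel) = (\<integral>\<^sup>+x. f x \<partial>lborel)"
  by (subst (2) lborel_distr_plus[of c, symmetric]) (simp add: nn_integral_distr)

lemma nn_integral_lborel_reflect:
  fixes f :: "'a::euclidean_space \<Rightarrow> ennreal"
  assumes [measurable]: "f \<in> borel_measurable borel"
  shows "(\<integral>\<^sup>+x. f (c - x) \<partial>lborel) = (\<integral>\<^sup>+x. f x \<partial>lborel)"
proof -
  have "lborel = density (distr lborel borel (\<lambda>x::'a. c + (-1) *\<^sub>R x)) (\<lambda>_. \<bar>-1::real\<bar>^DIM('a))"
    by (rule lborel_affine) simp
  then have "lborel = distr lborel borel (\<lambda>x::'a. c - x)"
    by (simp add: density_1)
  then have "(\<integral>\<^sup>+x. f x \<partial>lborel) = (\<integral>\<^sup>+x. f x \<partial>distr lborel borel (\<lambda>x::'a. c - x))"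
    by simp
  also have "\<dots> = (\<integral>\<^sup>+x. f (c - x) \<partial>lborel)"
    by (rule nn_integral_distr) auto
  finally show ?thesis by simp
qed

text \<open>
  Uniqueness of Haar measure: integrating \<open>indicator E (T x) * indicator B (T x + y)\<close> over \<open>x\<close> and
  \<open>y\<close> in either order, with \<open>B\<close> the \<open>T\<close>-invariant unit ball, compares \<open>T -` E\<close> with \<open>E\<close>.
\<close>
lemma emeasure_lborel_orthogonal_vimage:
  fixes T :: "'a::euclidean_space \<Rightarrow> 'a"
  assumes T: "orthogonal_transformation T" and E [measurable]: "E \<in> sets borel"
  shows "emeasure lborel (T -` E) = emeasure lborel E"
proof -
  define B where "B = ball (0::'a) 1"
  have [measurable]: "B \<in> sets borel" by (simp add: B_def)
  have [measurable]: "T \<in> borel_measurable borel"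
    using T by (rule orthogonal_transformation_borel_measurable)
  have lin: "linear T" using T by (rule orthogonal_transformation_linear)
  have surj: "surj T" using T by (rule orthogonal_transformation_surj)
  have TB: "T -` B = B"
    using orthogonal_transformation_norm[OF T] by (auto simp: B_def)
  have [measurable]: "T -` E \<in> sets borel"
    using measurable_sets_borel[OF \<open>T \<in> borel_measurable borel\<close> E] by simp
  have ind: "indicator A (T x) = (indicator (T -` A) x :: ennreal)" for A x
    by (simp add: indicator_def)
  have "emeasure lborel (T -` E) * emeasure lborel B
      = (\<integral>\<^sup>+x. indicator E (T x) * (\<integral>\<^sup>+y. indicator B (T x + y) \<partial>lborel) \<partial>lborel)"
  proof -
    have "(\<integral>\<^sup>+y. indicator B (T x + y) \<partial>lborel) = emeasure lborel B" for x
      by (subst nn_integral_lborel_shift) (auto intro!: borel_measurable_indicator)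
    moreover have "(\<integral>\<^sup>+x. indicator E (T x) \<partial>lborel) = emeasure lborel (T -` E)"
      unfolding ind by (rule nn_integral_indicator) simp
    ultimately show ?thesis
      by (simp add: nn_integral_multc)
  qed
  also have "\<dots> = (\<integral>\<^sup>+x. (\<integral>\<^sup>+y. indicator E (T x) * indicator B (T x + y) \<partial>lborel) \<partial>lborel)"
    by (simp add: nn_integral_cmult)
  also have "\<dots> = (\<integral>\<^sup>+y. (\<integral>\<^sup>+x. indicator E (T x) * indicator B (T x + y) \<partial>lborel) \<partial>lborel)"
    by (rule lborel_pair.Fubini') measurable
  also have "\<dots> = (\<integral>\<^sup>+y. (\<integral>\<^sup>+x. indicator E (T x - y) * indicator B (T x) \<partial>lborel) \<partial>lborel)"
  proof (rule nn_integral_cong)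
    fix y
    \<comment> \<open>Surjectivity turns the translation by \<open>y\<close> after \<open>T\<close>
      into the translation by \<open>c\<close> before \<open>T\<close>, so translation invariance in
      \<open>x\<close> applies and no determinant of \<open>T\<close> enters.\<close>
    obtain c where c: "y = T c" using surj by (metis surjD)
    have "(\<integral>\<^sup>+x. indicator E (T x - y) * indicator B (T x) \<partial>lborel)
        = (\<integral>\<^sup>+x. indicator E (T (c + x) - y) * indicator B (T (c + x)) \<partial>lborel)"
      by (subst nn_integral_lborel_shift[symmetric, of _ c]) measurable
    then show "(\<integral>\<^sup>+x. indicator E (T x) * indicator B (T x + y) \<partial>lborel)
        = (\<integral>\<^sup>+x. indicator E (T x - y) * indicator B (T x) \<partial>lborel)"
      by (simp add: c linear_add[OF lin] add.commute)
  qed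
  also have "\<dots> = (\<integral>\<^sup>+x. (\<integral>\<^sup>+y. indicator E (T x - y) * indicator B (T x) \<partial>lborel) \<partial>lborel)"
    by (rule lborel_pair.Fubini') measurable
  also have "\<dots> = (\<integral>\<^sup>+x. emeasure lborel E * indicator B (T x) \<partial>lborel)"
    by (simp add: nn_integral_multc nn_integral_lborel_reflect)
  also have "\<dots> = emeasure lborel E * emeasure lborel B"
  proof -
    have "(\<integral>\<^sup>+x. indicator B (T x) \<partial>lborel) = emeasure lborel B"
      unfolding ind TB by (rule nn_integral_indicator) simp
    then show ?thesis
      by (simp add: nn_integral_cmult)
  qed
  finally have "emeasure lborel (T -` E) * emeasure lborel B = emeasure lborel E * emeasure lborel B" .
  moreover have "emeasure lborel B \<noteq> 0"
    using content_ball_pos[of 1 "0::'a"] by (auto simp: measure_def B_def)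
  moreover have "emeasure lborel B \<noteq> top"
    using emeasure_lborel_ball_finite[of "0::'a" 1] by (auto simp: B_def)
  ultimately show ?thesis
    by (metis ennreal_mult_cancel_left mult.commute)
qed

lemma finite_measure_sphere_measure:
  "finite_measure (sphere_measure :: 'a::euclidean_space measure)"
  by (rule finite_measureI) (simp add: emeasure_sphere_measure_total)

lemma measure_sphere_measure_total:
  "measure (sphere_measure :: 'a::euclidean_space measure) (sphere 0 1) = 1"
  by (simp add: measure_def emeasure_sphere_measure_total)

text \<open>The dimension factor cancels in the normalisation. What remains is a ratio of Lebesgue
  volumes, which reduces questions about the sphere to questions about cones.\<close>

lemma emeasure_sphere_measure:
  fixes E :: "'a::euclidean_space set"
  assumes "E \<in> sets sphere_measure"
  shows "emeasure sphere_measure E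
    = emeasure lborel {x \<in> ball 0 1 - {0}. x /\<^sub>R norm x \<in> E} / emeasure lborel (ball (0::'a) 1)"
proof -
  have E: "E \<in> sets borel" "E \<subseteq> sphere 0 1" 
    using assms by (auto simp: sets_restrict_space_iff)
  have S: "sphere 0 1 \<in> sets (sphere_surface :: 'a measure)"
    by (simp add: sets_restrict_space_iff)
  have "emeasure sphere_measure E
     = emeasure sphere_surface E / emeasure (sphere_surface :: 'a measure) (sphere 0 1)"
    unfolding sphere_measure_def using E S assms
    by (subst emeasure_uniform_measure) (auto simp: Int_absorb1)
  then show ?thesis
    unfolding emeasure_sphere_surface[OF E] emeasure_sphere_surface_total
    by (simp only: mult.commute[of "of_nat DIM('a)"]) (subst divide_mult_eq, auto)
qed

lemma radial_cone_borel:
  fixes E :: "'a::euclidean_space set"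
  assumes "E \<in> sets borel"
  shows "{x \<in> ball 0 1 - {0}. x /\<^sub>R norm x \<in> E} \<in> sets borel"
proof -
  have [measurable]: "E \<in> sets borel" by fact
  have "{x \<in> ball 0 1 - {0}. x /\<^sub>R norm x \<in> E} = {x::'a. norm x < 1 \<and> x \<noteq> 0 \<and> x /\<^sub>R norm x \<in> E}"
    by auto
  also have "\<dots> \<in> sets borel" by measurable
  finally show ?thesis .
qed

text \<open>\<open>T\<close> preserves the norm and commutes with the radial projection, so the cone
  over a preimage is the preimage of the cone, and invariance of Lebesgue measure carries
  over.\<close>

lemma integral_sphere_measure_orthogonal:
  fixes f :: "'a::euclidean_space \<Rightarrow> 'b::{banach, second_countable_topology}"
  assumes T: "orthogonal_transformation (T :: 'a \<Rightarrow> 'a)" and f: "f \<in> borel_measurable sphere_measure"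
  shows "(LINT x|sphere_measure. f (T x)) = (LINT x|sphere_measure. f x)"
proof -
  have Tm: "T \<in> sphere_measure \<rightarrow>\<^sub>M sphere_measure"
  proof -
    have "T \<in> restrict_space borel (sphere 0 1) \<rightarrow>\<^sub>M restrict_space borel (sphere 0 1)"
      using orthogonal_transformation_norm[OF T] orthogonal_transformation_borel_measurable[OF T]
      by (intro measurable_restrict_space3) auto
    then show ?thesis
      by (simp cong: measurable_cong_sets)
  qed
  have "distr sphere_measure sphere_measure T = sphere_measure"
  proof (rule measure_eqI)
    fix E assume "E \<in> sets (distr sphere_measure sphere_measure T)"
    then have E: "E \<in> sets sphere_measure" by simp
    then have Eb: "E \<in> sets borel" by (auto simp: sets_restrict_space_iff)
    have "T -` E \<inter> space sphere_measure \<in> sets sphere_measure"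
      using Tm E by (rule measurable_sets)
    moreover have "{x \<in> ball 0 1 - {0}. x /\<^sub>R norm x \<in> T -` E \<inter> space sphere_measure}
       = T -` {x \<in> ball 0 1 - {0}. x /\<^sub>R norm x \<in> E}"
    proof -
      have "norm (T x) = norm x" "T x = 0 \<longleftrightarrow> x = 0" "T (x /\<^sub>R norm x) = T x /\<^sub>R norm x" for x
        using orthogonal_transformation_norm[OF T] orthogonal_transformation_linear[OF T]
        by (simp_all add: linear_scale) (metis norm_eq_zero)
      then show ?thesis by auto
    qed
    ultimately show "emeasure (distr sphere_measure sphere_measure T) E = emeasure sphere_measure E"
      by (simp only: emeasure_distr[OF Tm E] emeasure_sphere_measure[OF E] emeasure_sphere_measure
          emeasure_lborel_orthogonal_vimage[OF T radial_cone_borel[OF Eb]])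
  qed simp
  then show ?thesis
    using integral_distr[OF Tm f] by simp
qed

lemma sphere_measurable_continuous:
  fixes f :: "'a::euclidean_space \<Rightarrow> 'b::topological_space"
  assumes "continuous_on (sphere 0 1) f"
  shows "f \<in> borel_measurable sphere_measure"
  using borel_measurable_continuous_on_restrict[OF assms]
  by (simp cong: measurable_cong_sets)

lemma sphere_bounded_continuous:
  fixes f :: "'a::euclidean_space \<Rightarrow> 'b::real_normed_vector"
  assumes "continuous_on (sphere 0 1) f"
  obtains B where "0 \<le> B" "\<And>x. x \<in> sphere 0 1 \<Longrightarrow> norm (f x) \<le> B"
proof -
  have "bounded (f ` sphere 0 1)"
    using assms by (intro compact_imp_bounded compact_continuous_image) auto
  then obtain B where B: "\<forall>x\<in>sphere 0 1. norm (f x) \<le> B"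
    unfolding bounded_iff by blast
  show ?thesis
  proof (rule that[of "max B 0"])
    fix x :: 'a assume "x \<in> sphere 0 1"
    then show "norm (f x) \<le> max B 0" using B by (simp add: le_max_iff_disj)
  qed simp
qed

lemma sphere_integrable_continuous:
  fixes f :: "'a::euclidean_space \<Rightarrow> 'b::{banach, second_countable_topology}"
  assumes "continuous_on (sphere 0 1) f"
  shows "integrable sphere_measure f"
proof -
  interpret finite_measure "sphere_measure :: 'a measure" by (rule finite_measure_sphere_measure)
  obtain B where "\<And>x. x \<in> sphere 0 1 \<Longrightarrow> norm (f x) \<le> B"
    using assms by (rule sphere_bounded_continuous) blast
  then show ?thesis
    by (intro integrable_const_bound[where B = B] sphere_measurable_continuous assms)
       auto
qed

text \<open>If \<open>f z\<close> were nonzero, the cone over the set where \<open>f\<close> does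
  not vanish would be a nonempty open set, hence of positive volume, although \<open>f\<close>
  vanishes almost everywhere.\<close>

lemma sphere_integral_eq_0_imp:
  fixes f :: "'a::euclidean_space \<Rightarrow> real"
  assumes f: "continuous_on (sphere 0 1) f" "\<And>x. x \<in> sphere 0 1 \<Longrightarrow> 0 \<le> f x"
    and 0: "(LINT x|sphere_measure. f x) = 0" and z: "z \<in> sphere 0 1"
  shows "f z = 0"
proof (rule ccontr)
  assume nz: "f z \<noteq> 0"
  let ?E = "{x \<in> sphere 0 1. f x \<noteq> 0}"
  let ?C = "{x \<in> ball 0 1 - {0}. x /\<^sub>R norm x \<in> ?E}"
  have E: "?E \<in> sets sphere_measure"
  proof -
    have "f -` (- {0}) \<inter> space sphere_measure \<in> sets sphere_measure"
      by (rule measurable_sets[OF sphere_measurable_continuous[OF f(1)]]) auto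
    also have "f -` (- {0}) \<inter> space sphere_measure = ?E" by auto
    finally show ?thesis .
  qed
  have "AE x in sphere_measure. f x = 0"
    using 0 f(2) by (subst (asm) integral_nonneg_eq_0_iff_AE)
      (auto intro!: AE_I2 sphere_integrable_continuous f(1))
  then have "emeasure sphere_measure ?E = 0"
    using E by (subst (asm) AE_iff_measurable) auto
  then have "emeasure lborel ?C / emeasure lborel (ball (0::'a) 1) = 0"
    using emeasure_sphere_measure[OF E] by (rule trans[OF sym, rotated])
  moreover have "emeasure lborel (ball (0::'a) 1) \<noteq> top"
    using emeasure_lborel_ball_finite[of "0::'a" 1] by auto
  ultimately have C0: "emeasure lborel ?C = 0"
    by (simp only: ennreal_divide_eq_0_iff simp_thms)
  have unit: "x /\<^sub>R norm x \<in> sphere 0 1" if "x \<noteq> 0" for x :: 'a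
    using that by simp
  have "open ?C"
  proof -
    have "continuous_on (ball 0 1 - {0}) (\<lambda>x::'a. x /\<^sub>R norm x)"
      by (intro continuous_intros) simp
    moreover have "(\<lambda>x. x /\<^sub>R norm x) ` (ball 0 1 - {0}) \<subseteq> sphere (0::'a) 1"
      using unit by blast
    ultimately have "continuous_on (ball 0 1 - {0}) (\<lambda>x. f (x /\<^sub>R norm x))"
      by (rule continuous_on_compose2[OF f(1)])
    then have "open ((\<lambda>x. f (x /\<^sub>R norm x)) -` (- {0}) \<inter> (ball 0 1 - {0}))"
      by (rule continuous_on_open_vimage[THEN iffD1, rule_format, rotated]) (simp_all add: open_delete open_Compl)
    also have "(\<lambda>x. f (x /\<^sub>R norm x)) -` (- {0}) \<inter> (ball 0 1 - {0}) = ?C"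
      using unit by (intro set_eqI) (simp del: mem_sphere_0 add: conj_ac cong: conj_cong)
    finally show ?thesis .
  qed
  moreover have "?C \<noteq> {}"
  proof -
    have "norm z = 1" "z \<noteq> 0" using z by auto
    \<comment> \<open>Any radius strictly between 0 and 1 would do: the point lies in the punctured
      open ball and projects to \<open>z\<close>.\<close>
    then have "(1/2) *\<^sub>R z \<in> ?C" using nz by simp
    then show ?thesis by (rule ex_in_conv[THEN iffD1, OF exI])
  qed
  ultimately have "\<not> negligible ?C"
    by (rule open_not_negligible)
  moreover have "?C \<in> null_sets lebesgue"
    by (intro null_sets_completionI null_setsI C0) (simp only: sets_lborel borel_open \<open>open ?C\<close>)
  ultimately show False
    by (simp only: negligible_iff_null_sets simp_thms)
qed

section \<open>Complex matrices and the polar decomposition\<close>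

lemma hinner_add_left: "hinner (x + y) z = hinner x z + hinner y z"
  and hinner_add_right: "hinner x (y + z) = hinner x y + hinner x z"
  by (simp_all add: hinner_def algebra_simps sum.distrib)

lemma hinner_diff_left: "hinner (x - y) z = hinner x z - hinner y z"
  and hinner_diff_right: "hinner x (y - z) = hinner x y - hinner x z"
  by (simp_all add: hinner_def algebra_simps sum_subtractf)

lemma hinner_scale_left: "hinner (c *s x) y = c * hinner x y"
  and hinner_scale_right: "hinner x (c *s y) = cnj c * hinner x y"
  by (simp_all add: hinner_def sum_distrib_left mult_ac)

lemma hinner_zero [simp]: "hinner 0 x = 0" "hinner x 0 = 0"
  by (simp_all add: hinner_def)

lemma hinner_minus_right [simp]: "hinner x (- y) = - hinner x y"
  by (simp add: hinner_def sum_negf)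

lemma hinner_commute: "hinner y x = cnj (hinner x y)"
  by (simp add: hinner_def mult.commute)

lemma hinner_self: "hinner x x = complex_of_real ((norm x)\<^sup>2)"
proof -
  have "hinner x x = complex_of_real (\<Sum>i\<in>UNIV. (norm (x $ i))\<^sup>2)"
    by (simp add: hinner_def complex_norm_square del: of_real_power)
  then show ?thesis
    by (simp add: norm_vec_def L2_set_def sum_nonneg del: of_real_power)
qed

lemma hinner_self_eq_0 [simp]: "hinner x x = 0 \<longleftrightarrow> x = 0"
  by (simp add: hinner_self)

lemma hinner_adj: "hinner (A *v x) y = hinner x (adj A *v y)"
proof -
  have "hinner (A *v x) y = (\<Sum>i\<in>UNIV. \<Sum>j\<in>UNIV. A $ i $ j * x $ j * cnj (y $ i))"
    by (simp add: hinner_def matrix_vector_mult_def sum_distrib_right)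
  also have "\<dots> = (\<Sum>j\<in>UNIV. \<Sum>i\<in>UNIV. A $ i $ j * x $ j * cnj (y $ i))"
    by (rule sum.swap)
  also have "\<dots> = hinner x (adj A *v y)"
    by (simp add: hinner_def matrix_vector_mult_def adj_def sum_distrib_left mult_ac)
  finally show ?thesis .
qed

lemma adj_adj [simp]: "adj (adj A) = A"
  by (simp add: adj_def vec_eq_iff)

lemma adj_mult: "adj (A ** B) = adj B ** adj A"
  by (simp add: adj_def matrix_matrix_mult_def vec_eq_iff mult.commute)

lemma adj_add: "adj (A + B) = adj A + adj B" and adj_diff: "adj (A - B) = adj A - adj B"
  by (simp_all add: adj_def vec_eq_iff)

lemma adj_mat: "adj (mat c) = mat (cnj c)"
  by (auto simp: adj_def mat_def vec_eq_iff)

lemma matrix_diff_ldistrib: "(A :: 'a::ring_1^'n^'m) ** (B - C) = A ** B - A ** C"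
  and matrix_diff_rdistrib: "(B - C) ** (A :: 'a::ring_1^'n^'m) = B ** A - C ** A"
  by (simp_all add: matrix_matrix_mult_def vec_eq_iff algebra_simps sum_subtractf)

lemma matrix_add_rdistrib: "(B + C) ** (A :: 'a::semiring_1^'n^'m) = B ** A + C ** A"
  by (simp add: matrix_matrix_mult_def vec_eq_iff distrib_right sum.distrib)

lemma norm_unitary: "unitary_matrix U \<Longrightarrow> norm (U *v x) = norm x"
proof -
  assume U: "unitary_matrix U"
  have "hinner (U *v x) (U *v x) = hinner x x"
    using U by (simp add: hinner_adj matrix_vector_mul_assoc unitary_matrix_def)
  then show ?thesis
    by (simp only: hinner_self of_real_eq_iff) (simp add: power2_eq_iff_nonneg)
qed

lemma orthogonal_transformation_unitary:
  "unitary_matrix U \<Longrightarrow> orthogonal_transformation ((*v) U)"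
proof -
  have "linear ((*v) U)" for U :: "complex^'n^'n"
  proof (rule linearI)
    fix r :: real and x y :: "complex^'n"
    show "U *v (x + y) = U *v x + U *v y"
      by (rule matrix_vector_right_distrib)
    have "r *\<^sub>R x = complex_of_real r *s x" for x :: "complex^'n"
      by (simp add: vec_eq_iff scaleR_conv_of_real[where 'a=complex])
    then show "U *v (r *\<^sub>R x) = r *\<^sub>R (U *v x)"
      by (simp add: vector_scalar_commute)
  qed
  then show "unitary_matrix U \<Longrightarrow> orthogonal_transformation ((*v) U)"
    by (auto simp: orthogonal_transformation norm_unitary)
qed

text \<open>Polarisation: the vectors \<open>x + y\<close> and \<open>x + i y\<close> give the sum
  and the difference of the two mixed terms. Complex scalars are essential, since a real
  skew-symmetric matrix has zero quadratic form on real vectors.\<close>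

lemma matrix_zero_if_quadratic_zero:
  assumes "\<And>x. hinner (A *v x) x = 0"
  shows "A = 0"
proof -
  have "hinner (A *v x) y = 0" for x y
  proof -
    have "hinner (A *v (x + y)) (x + y) = 0" "hinner (A *v (x + \<i> *s y)) (x + \<i> *s y) = 0"
      by (rule assms)+
    then have "hinner (A *v x) y + hinner (A *v y) x = 0"
       "- \<i> * hinner (A *v x) y + \<i> * hinner (A *v y) x = 0"
      using assms[of x] assms[of y]
      by (simp_all add: matrix_vector_right_distrib hinner_add_left hinner_add_right
          vector_scalar_commute hinner_scale_left hinner_scale_right)
    then show ?thesis
      by (auto simp: add_eq_0_iff algebra_simps)
  qed
  then have "A *v x = 0" for x
    using hinner_self_eq_0 by blast
  then show ?thesis
    by (metis matrix_eq matrix_vector_mult_0)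
qed

text \<open>Moving from \<open>y\<close> in the direction \<open>- P y\<close> would decrease the
  form to first order by twice the squared norm of \<open>P y\<close>, below its value 0 at
  \<open>y\<close>.\<close>

lemma pos_semidef_hinner_eq_0:
  assumes P: "pos_semidef P" and 0: "Re (hinner (P *v y) y) = 0"
  shows "P *v y = 0"
proof (rule ccontr)
  assume nz: "P *v y \<noteq> 0"
  define w where "w = P *v y"
  define b where "b = Re (hinner (P *v w) w)"
  have sym: "hinner (P *v u) v = hinner u (P *v v)" for u v
    using P by (metis hinner_adj pos_semidef_def)
  have Re_w: "Re (hinner w w) = (norm w)\<^sup>2" by (simp add: hinner_self)
  have ineq: "0 \<le> - 2 * t * (norm w)\<^sup>2 + t\<^sup>2 * b" for t :: real
  proof -
    have "0 \<le> Re (hinner (P *v (y - of_real t *s w)) (y - of_real t *s w))"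
      using P by (simp add: pos_semidef_def)
    also have "\<dots> = Re (hinner (P *v y) y) - t * Re (hinner w w) - t * Re (hinner (P *v w) y) + t * t * b"
      by (simp add: matrix_vector_mult_diff_distrib hinner_diff_left hinner_diff_right vector_scalar_commute 
         hinner_scale_left hinner_scale_right w_def b_def algebra_simps)
    also have "hinner (P *v w) y = hinner w w"
      by (simp add: sym w_def)
    finally show ?thesis using 0 by (simp add: Re_w power2_eq_square)
  qed
  have pos: "(norm w)\<^sup>2 > 0" using nz by (simp add: w_def)
  have b: "0 \<le> b" using P by (simp add: b_def pos_semidef_def)
  \<comment> \<open>The quadratic in \<open>t\<close> is minimal at \<open>(norm w)^2 / b\<close>;
    the denominator \<open>b + 1\<close> covers \<open>b = 0\<close> and still gives a negative
    value.\<close>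
  have "0 \<le> - 2 * ((norm w)\<^sup>2 / (b + 1)) * (norm w)\<^sup>2 + ((norm w)\<^sup>2 / (b + 1))\<^sup>2 * b"
    by (rule ineq)
  also have "\<dots> = ((norm w)\<^sup>2)\<^sup>2 / (b + 1) * (b / (b + 1) - 2)"
    using b by (simp add: power2_eq_square divide_simps) (simp add: algebra_simps)?
  also have "\<dots> < 0"
    using pos b by (intro mult_pos_neg divide_pos_pos) (auto simp: field_simps)
  finally show False by simp
qed

lemma trace_conv_hinner: "trace A = (\<Sum>i\<in>UNIV. hinner (A *v axis i 1) (axis i 1))"
  by (simp add: trace_def hinner_def matrix_vector_mult_def axis_def if_distrib cong: if_cong)

lemma trace_mult_adj: "trace (A ** adj A) = complex_of_real (\<Sum>i\<in>UNIV. \<Sum>j\<in>UNIV. (cmod (A $ i $ j))\<^sup>2)"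
  by (simp add: trace_def matrix_matrix_mult_def adj_def complex_norm_square del: of_real_power)

text \<open>With \<open>D = P - Q\<close>, the equation \<open>P D + D Q = P^2 - Q^2 = 0\<close>
  holds without commutation. Multiplying by \<open>D\<close> and taking the trace gives a vanishing
  sum of nonnegative terms, whence \<open>P D = Q D = 0\<close>, then \<open>D^2 = 0\<close>, and
  \<open>D = 0\<close> because \<open>D\<close> is Hermitian.\<close>

lemma pos_semidef_square_unique:
  fixes P :: "complex^'n^'n"
  assumes P: "pos_semidef P" and Q: "pos_semidef Q" and eq: "P ** P = Q ** Q"
  shows "P = Q"
proof -
  define D where "D = P - Q"
  have D: "adj D = D" using P Q by (simp add: D_def adj_diff pos_semidef_def)
  have PD: "P ** D + D ** Q = 0"
    by (simp add: D_def matrix_diff_ldistrib matrix_diff_rdistrib eq)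
  have "trace (D ** (P ** D)) + trace (D ** Q ** D) = trace (D ** (P ** D + D ** Q))"
    by (simp add: matrix_add_ldistrib trace_add trace_mul_sym[of "D ** Q"])
  also have "\<dots> = trace (0 :: complex^'n^'n)" by (simp add: PD)
  also have "trace (0 :: complex^'n^'n) = 0" by (simp add: trace_def)
  finally have "(\<Sum>i\<in>UNIV. hinner (P *v (D *v axis i 1)) (D *v axis i 1) + hinner (Q *v (D *v axis i 1)) (D *v axis i 1)) = 0"
    unfolding trace_conv_hinner
    by (simp add: sum.distrib hinner_adj[of D] D matrix_vector_mul_assoc[symmetric])
  then have "(\<Sum>i\<in>UNIV. Re (hinner (P *v (D *v axis i 1)) (D *v axis i 1)) + Re (hinner (Q *v (D *v axis i 1)) (D *v axis i 1))) = 0"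
    by (metis (no_types, lifting) Re_sum plus_complex.simps(1) sum.cong zero_complex.simps(1))
  then have "\<forall>i\<in>UNIV. Re (hinner (P *v (D *v axis i 1)) (D *v axis i 1)) + Re (hinner (Q *v (D *v axis i 1)) (D *v axis i 1)) = 0"
    using P Q by (subst (asm) sum_nonneg_eq_0_iff) (auto simp: pos_semidef_def)
  then have "Re (hinner (P *v (D *v axis i 1)) (D *v axis i 1)) = 0" 
      "Re (hinner (Q *v (D *v axis i 1)) (D *v axis i 1)) = 0" for i
    using P Q unfolding pos_semidef_def by (smt (verit) UNIV_I)+
  then have "P *v (D *v axis i 1) = 0" "Q *v (D *v axis i 1) = 0" for i
    using P Q pos_semidef_hinner_eq_0 by blast+
  then have "D *v (D *v axis i 1) = 0" for i
    by (metis D_def diff_zero matrix_vector_mult_diff_rdistrib)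
  then have "hinner (D *v axis i 1) (D *v axis i 1) = 0" for i
    by (metis D hinner_adj hinner_zero(2))
  then have "D *v axis i 1 = 0" for i by simp
  then have "D = 0"
    by (simp add: vec_eq_iff matrix_vector_mult_def axis_def if_distrib cong: if_cong)
  then show ?thesis by (simp add: D_def)
qed

section \<open>The unitary group and the existence of the polar decomposition\<close>

lemma unitary_matrixI: "adj U ** U = mat 1 \<Longrightarrow> unitary_matrix U"
  unfolding unitary_matrix_def by (rule conjI, assumption, rule matrix_left_right_inverse[THEN iffD1])

lemma unitary_matrix_mult:
  assumes "unitary_matrix U" "unitary_matrix V"
  shows "unitary_matrix (U ** V)"
proof (rule unitary_matrixI)
  have "adj (U ** V) ** (U ** V) = adj V ** (adj U ** U) ** V"
    by (simp add: adj_mult matrix_mul_assoc)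
  then show "adj (U ** V) ** (U ** V) = mat 1"
    using assms by (simp add: unitary_matrix_def)
qed

lemma unitary_matrix_adj: "unitary_matrix U \<Longrightarrow> unitary_matrix (adj U)"
  by (simp add: unitary_matrix_def)

lemma unitary_matrix_one: "unitary_matrix (mat 1)"
  by (simp add: unitary_matrix_def adj_mat)

lemma norm_matrix_power2: "(norm A)\<^sup>2 = (\<Sum>i\<in>UNIV. \<Sum>j\<in>UNIV. (cmod (A $ i $ j))\<^sup>2)"
  by (simp add: norm_vec_def L2_set_def sum_nonneg)

text \<open>Supplies the maximiser in the polar decomposition. The norm on matrices here is the
  Frobenius norm, so every unitary matrix has norm \<open>sqrt n\<close>.\<close>

lemma compact_unitary: "compact {U :: complex^'n^'n. unitary_matrix U}"
proof -
  have "norm U \<le> sqrt (real CARD('n))" if "unitary_matrix U" for U :: "complex^'n^'n"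
  proof -
    have "complex_of_real ((norm U)\<^sup>2) = trace (mat 1 :: complex^'n^'n)"
      using that trace_mult_adj[of U] unfolding norm_matrix_power2 unitary_matrix_def by simp
    also have "\<dots> = complex_of_real (real CARD('n))"
      by (simp add: trace_def mat_def)
    finally show ?thesis
      by (metis of_real_eq_iff order_refl real_le_rsqrt)
  qed
  then have "bounded {U :: complex^'n^'n. unitary_matrix U}"
    unfolding bounded_iff by blast
  moreover have "closed {U :: complex^'n^'n. unitary_matrix U}"
    unfolding unitary_matrix_def adj_def matrix_matrix_mult_def
    by (intro closed_Collect_conj closed_Collect_eq continuous_intros)
  ultimately show ?thesis
    by (simp add: compact_eq_bounded_closed)
qed

text \<open>For a unit vector \<open>x\<close> this map multiplies \<open>x\<close> by
  \<open>\<omega>\<close> and fixes the orthogonal complement of \<open>x\<close>.\<close>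

definition phase_reflection :: "complex \<Rightarrow> complex^'n \<Rightarrow> complex^'n^'n" where
  "phase_reflection \<omega> x = mat 1 + (\<chi> i j. (\<omega> - 1) * x $ i * cnj (x $ j))"

lemma phase_reflection_vec: "phase_reflection \<omega> x *v v = v + ((\<omega> - 1) * hinner v x) *s x"
  by (simp add: phase_reflection_def matrix_vector_mult_add_rdistrib)
    (simp add: matrix_vector_mult_def vec_eq_iff hinner_def sum_distrib_left sum_distrib_right mult_ac)

lemma adj_phase_reflection: "adj (phase_reflection \<omega> x) = phase_reflection (cnj \<omega>) x"
  by (auto simp: phase_reflection_def adj_def vec_eq_iff mat_def)

lemma unitary_phase_reflection:
  assumes x: "hinner x x = 1" and \<omega>: "\<omega> * cnj \<omega> = 1"
  shows "unitary_matrix (phase_reflection \<omega> x)"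
proof (rule unitary_matrixI)
  have "phase_reflection (cnj \<omega>) x *v (phase_reflection \<omega> x *v v) = v" for v
  proof -
    have "phase_reflection (cnj \<omega>) x *v (phase_reflection \<omega> x *v v)
       = v + ((\<omega> - 1) * hinner v x + (cnj \<omega> - 1) * (hinner v x + (\<omega> - 1) * hinner v x * hinner x x)) *s x"
      by (simp add: phase_reflection_vec hinner_add_left hinner_scale_left vector_sadd_rdistrib add.assoc)
    also have "(\<omega> - 1) * hinner v x + (cnj \<omega> - 1) * (hinner v x + (\<omega> - 1) * hinner v x * hinner x x)
       = (\<omega> * cnj \<omega> - 1) * hinner v x"
      by (simp add: x algebra_simps)
    finally show ?thesis by (simp add: \<omega>)
  qed
  then show "adj (phase_reflection \<omega> x) ** phase_reflection \<omega> x = mat 1"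
    by (simp add: matrix_eq adj_phase_reflection matrix_vector_mul_assoc[symmetric])
qed

lemma trace_phase_reflection_mult:
  "trace (phase_reflection \<omega> x ** P) = trace P + (\<omega> - 1) * hinner (P *v x) x"
proof -
  have "trace (phase_reflection \<omega> x ** P)
     = trace P + (\<Sum>i\<in>UNIV. \<Sum>k\<in>UNIV. (\<omega> - 1) * (x $ i * cnj (x $ k) * P $ k $ i))"
    by (simp add: phase_reflection_def matrix_add_rdistrib trace_add)
       (simp add: trace_def matrix_matrix_mult_def mult.assoc)
  also have "(\<Sum>i\<in>UNIV. \<Sum>k\<in>UNIV. (\<omega> - 1) * (x $ i * cnj (x $ k) * P $ k $ i)) = (\<omega> - 1) * hinner (P *v x) x"
    by (subst sum.swap) (simp add: hinner_def matrix_vector_mult_def sum_distrib_left sum_distrib_right mult_ac)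
  finally show ?thesis .
qed

text \<open>
  A unitary \<open>U\<close> maximising \<open>Re (trace (U ** A))\<close> makes \<open>U ** A\<close> positive semidefinite, since no
  phase reflection in a vector can increase the trace further.
\<close>
lemma polar_decomposition:
  fixes A :: "complex^'n^'n"
  obtains U where "unitary_matrix U" "pos_semidef (U ** A)"
proof -
  have "continuous_on {U :: complex^'n^'n. unitary_matrix U} (\<lambda>U. Re (trace (U ** A)))"
    unfolding trace_def matrix_matrix_mult_def by (simp, intro continuous_intros)
  moreover have "{U :: complex^'n^'n. unitary_matrix U} \<noteq> {}"
    using unitary_matrix_one by auto
  ultimately have "\<exists>U\<in>{U. unitary_matrix U}. \<forall>V\<in>{U. unitary_matrix U}.
      Re (trace (V ** A)) \<le> Re (trace (U ** A))"
    by (intro continuous_attains_sup[of "{U. unitary_matrix U}" "\<lambda>U. Re (trace (U ** A))"] compact_unitary)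
  then obtain U where U: "unitary_matrix U"
    and max: "\<And>V. unitary_matrix V \<Longrightarrow> Re (trace (V ** A)) \<le> Re (trace (U ** A))"
    by auto
  define P where "P = U ** A"
  have unit: "hinner (P *v x) x = of_real (cmod (hinner (P *v x) x))" if x: "hinner x x = 1" for x
  proof (cases "hinner (P *v x) x = 0")
    case False
    define c where "c = hinner (P *v x) x"
    \<comment> \<open>The opposite phase of \<open>c\<close>: replacing \<open>U\<close> by the
      reflected matrix would raise the real trace by \<open>cmod c - Re c\<close>, so maximality
      forces \<open>c\<close> to be real and nonnegative.\<close>
    define \<omega> where "\<omega> = cnj c / of_real (cmod c)"
    have c: "c \<noteq> 0" using False by (simp add: c_def)
    have cc: "c * cnj c = of_real (cmod c) * of_real (cmod c)"
      using complex_norm_square[of c] by (simp add: power2_eq_square)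
    have "\<omega> * cnj \<omega> = 1" using c cc by (simp add: \<omega>_def mult.commute)
    then have "unitary_matrix (phase_reflection \<omega> x ** U)"
      by (intro unitary_matrix_mult unitary_phase_reflection x U)
    then have "Re (trace (phase_reflection \<omega> x ** P)) \<le> Re (trace P)"
      using max unfolding P_def by (simp add: matrix_mul_assoc)
    then have "Re ((\<omega> - 1) * c) \<le> 0"
      by (simp add: trace_phase_reflection_mult c_def)
    moreover have "\<omega> * c = of_real (cmod c)"
      using c cc by (simp add: \<omega>_def mult.commute)
    ultimately have le: "cmod c \<le> Re c"
      by (simp add: left_diff_distrib)
    then have "Im c = 0" "Re c = cmod c"
      using complex_Re_le_cmod[of c] cmod_power2[of c] by auto
    then show ?thesis
      by (simp add: c_def complex_eq_iff)
  qed simp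
  have real: "hinner (P *v x) x = of_real (cmod (hinner (P *v x) x))" for x
  proof (cases "x = 0")
    case False
    define y where "y = of_real (inverse (norm x)) *s x"
    have xy: "x = of_real (norm x) *s y"
      using False by (simp add: y_def)
    have "hinner y y = of_real (inverse (norm x)) * of_real (inverse (norm x)) * hinner x x"
      unfolding y_def hinner_scale_left hinner_scale_right by simp
    also have "\<dots> = 1"
      using False by (simp add: hinner_self power2_eq_square field_simps)
    finally have "hinner y y = 1" .
    then obtain r where "hinner (P *v y) y = of_real r" "0 \<le> r"
      by (rule that[OF unit norm_ge_zero])
    moreover have "hinner (P *v x) x = of_real ((norm x)\<^sup>2) * hinner (P *v y) y"
      by (subst (1 2) xy) (simp add: vector_scalar_commute hinner_scale_left hinner_scale_right power2_eq_square)
    ultimately have "hinner (P *v x) x = of_real ((norm x)\<^sup>2 * r)" "0 \<le> (norm x)\<^sup>2 * r"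
      by simp_all
    then show ?thesis
      by (simp only: norm_of_real abs_of_nonneg)
  qed simp
  \<comment> \<open>The form of \<open>P\<close> is real on all vectors, so it agrees with the form
    of \<open>adj P\<close>; polarisation then makes \<open>P\<close> Hermitian.\<close>
  have "hinner ((P - adj P) *v x) x = 0" for x
  proof -
    have "hinner (adj P *v x) x = cnj (hinner (P *v x) x)"
      by (simp only: hinner_adj[of "adj P"] adj_adj) (rule hinner_commute)
    also have "\<dots> = hinner (P *v x) x"
      by (subst real, subst (2) real) simp
    finally show ?thesis
      by (simp add: matrix_vector_mult_diff_rdistrib hinner_diff_left)
  qed
  then have "adj P = P"
    using matrix_zero_if_quadratic_zero[of "P - adj P"] by simp
  moreover have "0 \<le> Re (hinner (P *v x) x)" for x
    by (subst real) simp
  ultimately have "pos_semidef P" by (simp add: pos_semidef_def)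
  then show ?thesis
    by (intro that[OF U]) (simp only: P_def)
qed

text \<open>\<open>matrix_sqrt\<close> is a definite description and needs both existence and
  uniqueness. The positive factor \<open>U ** A\<close> exists by polar decomposition, and being
  Hermitian it squares to \<open>adj A ** adj U ** U ** A = adj A ** A\<close>.\<close>

lemma matrix_abs_square: "matrix_abs A ** matrix_abs A = adj A ** A"
proof -
  obtain U where U: "unitary_matrix U" "pos_semidef (U ** A)"
    by (rule polar_decomposition)
  have "(U ** A) ** (U ** A) = adj (U ** A) ** (U ** A)"
    using U by (simp add: pos_semidef_def)
  also have "\<dots> = adj A ** (adj U ** U) ** A"
    by (simp add: adj_mult matrix_mul_assoc)
  finally have sq: "(U ** A) ** (U ** A) = adj A ** A"
    using U by (simp add: unitary_matrix_def)
  have "Q = U ** A" if "pos_semidef Q \<and> Q ** Q = adj A ** A" for Q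
    by (rule pos_semidef_square_unique) (use that U sq in simp_all)
  moreover have "pos_semidef (U ** A) \<and> (U ** A) ** (U ** A) = adj A ** A"
    by (rule conjI[OF U(2) sq])
  ultimately have "pos_semidef (matrix_abs A) \<and> matrix_abs A ** matrix_abs A = adj A ** A"
    unfolding matrix_abs_def matrix_sqrt_def by (rule theI[rotated])
  then show ?thesis by simp
qed

lemma power4_powr_quarter: "0 \<le> x \<Longrightarrow> (x powr (1/4)) ^ 4 = (x::real)"
  by (simp add: powr_powr flip: powr_numeral)

lemma schatten4_norm_power4:
  "schatten4_norm A ^ 4 = Re (trace (A ** adj A ** A ** adj A))"
proof -
  have "trace (matrix_abs A ** matrix_abs A ** matrix_abs A ** matrix_abs A)
     = trace ((adj A ** A) ** (adj A ** A))"
    by (simp only: matrix_abs_square[symmetric] matrix_mul_assoc)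
  also have "(adj A ** A) ** (adj A ** A) = adj A ** (A ** adj A ** A)"
    by (simp only: matrix_mul_assoc)
  also have "trace (adj A ** (A ** adj A ** A)) = trace (A ** adj A ** A ** adj A)"
    by (rule trace_mul_sym)
  \<comment> \<open>Written as \<open>X ** adj X\<close> with \<open>X = A ** adj A\<close>, the
    matrix visibly has real nonnegative trace, so the fourth power undoes
    \<open>powr (1/4)\<close>.\<close>
  also have "A ** adj A ** A ** adj A = A ** adj A ** adj (A ** adj A)"
    by (simp only: adj_mult adj_adj matrix_mul_assoc)
  finally have "schatten4_norm A = Re (trace (A ** adj A ** adj (A ** adj A))) powr (1/4)"
    by (simp add: schatten4_norm_def)
  moreover have "Re (trace (A ** adj A ** adj (A ** adj A))) \<ge> 0"
    by (simp add: trace_mult_adj sum_nonneg)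
  ultimately show ?thesis
    by (simp add: power4_powr_quarter adj_mult matrix_mul_assoc)
qed

lemma adj_scaleR: "adj (r *\<^sub>R A) = r *\<^sub>R adj A"
  by (simp add: adj_def vec_eq_iff)

section \<open>Moments of quadratic forms\<close>

lemma uminus_matrix_vector: "(- A) *v x = - (A *v (x :: complex^'n))"
  by (simp add: matrix_vector_mult_def vec_eq_iff sum_negf)

lemma scaleR_matrix_vector: "(r *\<^sub>R A) *v x = r *\<^sub>R (A *v (x :: complex^'n))"
  and matrix_vector_scaleR: "A *v (r *\<^sub>R x) = r *\<^sub>R (A *v (x :: complex^'n))"
  by (simp_all add: matrix_vector_mult_def vec_eq_iff scaleR_sum_right)

text \<open>Using the sine as parameter makes the term in \<open>H\<close> exactly linear in
  \<open>s\<close>. The only remainder is then the algebraic coefficient of \<open>H ** H\<close>,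
  which is of order \<open>s^2\<close>.\<close>

definition skew_unitary :: "complex^'n^'n \<Rightarrow> real \<Rightarrow> complex^'n^'n" where
  "skew_unitary H s = mat 1 + s *\<^sub>R H + (1 - sqrt (1 - s\<^sup>2)) *\<^sub>R (H ** H)"

lemma skew_unitary_vec:
  "skew_unitary H s *v v = v + s *\<^sub>R (H *v v) + (1 - sqrt (1 - s\<^sup>2)) *\<^sub>R (H *v (H *v v))"
  by (simp add: skew_unitary_def matrix_vector_mult_add_rdistrib scaleR_matrix_vector matrix_vector_mul_assoc)

lemma adj_skew_unitary_vec:
  assumes H: "adj H = - H"
  shows "adj (skew_unitary H s) *v v = v - s *\<^sub>R (H *v v) + (1 - sqrt (1 - s\<^sup>2)) *\<^sub>R (H *v (H *v v))"
proof -
  have "H *v (- w) = - (H *v w)" for w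
    by (simp add: matrix_vector_mult_def vec_eq_iff sum_negf)
  then show ?thesis
    by (simp add: uminus_matrix_vector skew_unitary_def adj_add adj_mat adj_scaleR adj_mult H matrix_vector_mult_add_rdistrib
        matrix_vector_mult_diff_rdistrib scaleR_matrix_vector matrix_vector_mul_assoc[symmetric])
qed

text \<open>If \<open>H\<close> is skew-Hermitian with eigenvalues in \<open>{\<i>, - \<i>, 0}\<close>, then \<open>skew_unitary H (sin t)\<close> is
  the exponential of \<open>t H\<close>.\<close>
lemma unitary_skew_unitary:
  assumes H: "adj H = - H" "H ** H ** H = - H" and s: "0 \<le> s" "s \<le> 1"
  shows "unitary_matrix (skew_unitary H s)"
proof (rule unitary_matrixI)
  define c where "c = 1 - sqrt (1 - s\<^sup>2)"
  have "s\<^sup>2 \<le> 1" using s by (simp add: power_le_one)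
  \<comment> \<open>This is \<open>sin^2 + cos^2 = 1\<close> with \<open>c = 1 - cos\<close>; the
    left-hand side is the coefficient of \<open>H ** H\<close> in \<open>adj U ** U\<close>.\<close>
  then have c: "2 * c - s\<^sup>2 - c\<^sup>2 = 0"
    by (simp add: c_def power2_diff)
  have "adj (skew_unitary H s) *v (skew_unitary H s *v v) = v" for v
  proof -
    define w q where "w = H *v v" and "q = H *v w"
    have Hq: "H *v q = - w"
    proof -
      have "H *v q = (H ** H ** H) *v v"
        by (simp add: q_def w_def matrix_vector_mul_assoc matrix_mul_assoc)
      also have "\<dots> = - w"
        by (simp add: H w_def uminus_matrix_vector)
      finally show ?thesis .
    qed
    have y: "skew_unitary H s *v v = v + s *\<^sub>R w + c *\<^sub>R q"
      by (simp add: skew_unitary_vec c_def w_def q_def)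
    have Hy: "H *v (v + s *\<^sub>R w + c *\<^sub>R q) = w + s *\<^sub>R q - c *\<^sub>R w"
      by (simp add: matrix_vector_right_distrib matrix_vector_scaleR Hq flip: w_def q_def)
    have HHy: "H *v (w + s *\<^sub>R q - c *\<^sub>R w) = q - s *\<^sub>R w - c *\<^sub>R q"
      by (simp add: matrix_vector_right_distrib matrix_vector_mult_diff_distrib matrix_vector_scaleR Hq flip: q_def)
    have "adj (skew_unitary H s) *v (skew_unitary H s *v v)
       = (v + s *\<^sub>R w + c *\<^sub>R q) - s *\<^sub>R (w + s *\<^sub>R q - c *\<^sub>R w) + c *\<^sub>R (q - s *\<^sub>R w - c *\<^sub>R q)"
      unfolding adj_skew_unitary_vec[OF H(1)] y Hy HHy c_def[symmetric] ..
    also have "\<dots> = v + (c + c - s\<^sup>2 - c\<^sup>2) *\<^sub>R q"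
      unfolding vec_eq_iff by (simp add: scaleR_conv_of_real algebra_simps power2_eq_square)
    finally show ?thesis using c by simp
  qed
  then show "adj (skew_unitary H s) ** skew_unitary H s = mat 1"
    by (simp add: matrix_eq matrix_vector_mul_assoc[symmetric])
qed

lemma continuous_on_matrix_vector [continuous_intros]:
  "continuous_on S f \<Longrightarrow> continuous_on S (\<lambda>x. (A :: complex^'n^'m) *v f x)"
  unfolding matrix_vector_mult_def by (intro continuous_intros)

lemma continuous_on_hinner [continuous_intros]:
  "continuous_on S f \<Longrightarrow> continuous_on S g \<Longrightarrow> continuous_on S (\<lambda>x. hinner (f x) (g x))"
  unfolding hinner_def by (intro continuous_intros)

lemma continuous_on_quadratic_form [continuous_intros]: "continuous_on S (quadratic_form A)"
  unfolding quadratic_form_def[abs_def] by (intro continuous_intros)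

text \<open>
  \<open>g\<close> is the derivative of \<open>f\<close> along the curve \<open>skew_unitary H\<close>, with a quadratic error bound that is
  uniform on the sphere; the uniformity replaces differentiation under the integral sign.
\<close>
definition flow_deriv :: "complex^'n^'n \<Rightarrow> (complex^'n \<Rightarrow> complex) \<Rightarrow> (complex^'n \<Rightarrow> complex) \<Rightarrow> bool" where
  "flow_deriv H f g \<longleftrightarrow> continuous_on (sphere 0 1) f \<and> continuous_on (sphere 0 1) g \<and>
     (\<exists>C\<ge>0. \<forall>s\<in>{0..1}. \<forall>z\<in>sphere 0 1.
        cmod (f (skew_unitary H s *v z) - f z - of_real s * g z) \<le> C * s\<^sup>2)"

lemma flow_derivI:
  assumes "continuous_on (sphere 0 1) f" "continuous_on (sphere 0 1) g" "0 \<le> C"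
    "\<And>s z. 0 \<le> s \<Longrightarrow> s \<le> 1 \<Longrightarrow> z \<in> sphere 0 1 \<Longrightarrow>
        cmod (f (skew_unitary H s *v z) - f z - of_real s * g z) \<le> C * s\<^sup>2"
  shows "flow_deriv H f g"
  unfolding flow_deriv_def using assms by auto

lemma flow_derivE:
  assumes "flow_deriv H f g"
  obtains C where "continuous_on (sphere 0 1) f" "continuous_on (sphere 0 1) g" "0 \<le> C"
    "\<And>s z. 0 \<le> s \<Longrightarrow> s \<le> 1 \<Longrightarrow> z \<in> sphere 0 1 \<Longrightarrow>
        cmod (f (skew_unitary H s *v z) - f z - of_real s * g z) \<le> C * s\<^sup>2"
  using assms unfolding flow_deriv_def by auto

lemma flow_deriv_const: "flow_deriv H (\<lambda>_. c) (\<lambda>_. 0)"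
  by (rule flow_derivI[where C = 0]) (auto intro!: continuous_intros)

lemma flow_deriv_coordinate: "flow_deriv H (\<lambda>z. z $ i) (\<lambda>z. (H *v z) $ i)"
proof -
  have "continuous_on (sphere 0 1) (\<lambda>z. (H *v (H *v z)) $ i)"
    by (intro continuous_intros)
  then obtain B where B: "0 \<le> B" "\<And>z. z \<in> sphere 0 1 \<Longrightarrow> cmod ((H *v (H *v z)) $ i) \<le> B"
    by (rule sphere_bounded_continuous) blast
  show ?thesis
  proof (rule flow_derivI[OF _ _ B(1)])
    fix s :: real and z :: "complex^'a" assume s: "0 \<le> s" "s \<le> 1" and z: "z \<in> sphere 0 1"
    have "0 \<le> 1 - s\<^sup>2" "1 - s\<^sup>2 \<le> 1" using s by (simp_all add: power_le_one)
    \<comment> \<open>A number in \<open>[0, 1]\<close> is at most its own square root; this bounds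
      \<open>1 - sqrt (1 - s^2)\<close> by \<open>s^2\<close> without calculus.\<close>
    then have "(1 - s\<^sup>2) * (1 - s\<^sup>2) \<le> 1 - s\<^sup>2" by (intro mult_left_le)
    then have "1 - s\<^sup>2 \<le> sqrt (1 - s\<^sup>2)"
      by (intro real_le_rsqrt) (simp only: power2_eq_square)
    moreover have "sqrt (1 - s\<^sup>2) \<le> 1"
      using \<open>1 - s\<^sup>2 \<le> 1\<close> by (simp only: real_sqrt_le_1_iff)
    ultimately have c: "\<bar>1 - sqrt (1 - s\<^sup>2)\<bar> \<le> s\<^sup>2" by linarith
    have "(skew_unitary H s *v z) $ i - z $ i - of_real s * (H *v z) $ i
       = of_real (1 - sqrt (1 - s\<^sup>2)) * (H *v (H *v z)) $ i"
      unfolding skew_unitary_vec vector_add_component vector_scaleR_component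
      scaleR_conv_of_real[where 'a = complex] by simp
    then have "cmod ((skew_unitary H s *v z) $ i - z $ i - of_real s * (H *v z) $ i)
       = \<bar>1 - sqrt (1 - s\<^sup>2)\<bar> * cmod ((H *v (H *v z)) $ i)"
      by (simp only: norm_mult norm_of_real)
    also have "\<dots> \<le> s\<^sup>2 * B"
      using c B(2)[OF z] by (intro mult_mono) auto
    finally show "cmod ((skew_unitary H s *v z) $ i - z $ i - of_real s * (H *v z) $ i) \<le> B * s\<^sup>2"
      by (simp add: mult.commute)
  qed (intro continuous_intros)+
qed

lemma flow_deriv_cnj:
  assumes "flow_deriv H f g"
  shows "flow_deriv H (\<lambda>z. cnj (f z)) (\<lambda>z. cnj (g z))"
proof -
  obtain C where C: "continuous_on (sphere 0 1) f" "continuous_on (sphere 0 1) g" "0 \<le> C"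
    "\<And>s z. 0 \<le> s \<Longrightarrow> s \<le> 1 \<Longrightarrow> z \<in> sphere 0 1 \<Longrightarrow>
        cmod (f (skew_unitary H s *v z) - f z - of_real s * g z) \<le> C * s\<^sup>2"
    using assms by (rule flow_derivE) blast
  show ?thesis
  proof (rule flow_derivI[OF _ _ C(3)])
    fix s :: real and z :: "complex^'a" assume s: "0 \<le> s" "s \<le> 1" and z: "z \<in> sphere 0 1"
    have "cnj (f (skew_unitary H s *v z)) - cnj (f z) - of_real s * cnj (g z)
       = cnj (f (skew_unitary H s *v z) - f z - of_real s * g z)" by simp
    then show "cmod (cnj (f (skew_unitary H s *v z)) - cnj (f z) - of_real s * cnj (g z)) \<le> C * s\<^sup>2"
      using C(4)[OF s z] by (simp only: complex_mod_cnj)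
  qed (intro continuous_intros C)+
qed

lemma flow_deriv_add:
  assumes "flow_deriv H f1 g1" "flow_deriv H f2 g2"
  shows "flow_deriv H (\<lambda>z. f1 z + f2 z) (\<lambda>z. g1 z + g2 z)"
proof -
  obtain C1 where C1: "continuous_on (sphere 0 1) f1" "continuous_on (sphere 0 1) g1" "0 \<le> C1"
    "\<And>s z. 0 \<le> s \<Longrightarrow> s \<le> 1 \<Longrightarrow> z \<in> sphere 0 1 \<Longrightarrow>
        cmod (f1 (skew_unitary H s *v z) - f1 z - of_real s * g1 z) \<le> C1 * s\<^sup>2"
    using assms(1) by (rule flow_derivE) blast
  obtain C2 where C2: "continuous_on (sphere 0 1) f2" "continuous_on (sphere 0 1) g2" "0 \<le> C2"
    "\<And>s z. 0 \<le> s \<Longrightarrow> s \<le> 1 \<Longrightarrow> z \<in> sphere 0 1 \<Longrightarrow>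
        cmod (f2 (skew_unitary H s *v z) - f2 z - of_real s * g2 z) \<le> C2 * s\<^sup>2"
    using assms(2) by (rule flow_derivE) blast
  show ?thesis
  proof (rule flow_derivI[where C = "C1 + C2"])
    fix s :: real and z :: "complex^'a" assume s: "0 \<le> s" "s \<le> 1" and z: "z \<in> sphere 0 1"
    let ?z = "skew_unitary H s *v z"
    have "f1 ?z + f2 ?z - (f1 z + f2 z) - of_real s * (g1 z + g2 z)
       = (f1 ?z - f1 z - of_real s * g1 z) + (f2 ?z - f2 z - of_real s * g2 z)"
      by (simp add: algebra_simps)
    also have "cmod \<dots> \<le> (C1 + C2) * s\<^sup>2"
      using norm_triangle_mono[OF C1(4)[OF s z] C2(4)[OF s z]] by (simp only: distrib_right)
    finally show "cmod (f1 ?z + f2 ?z - (f1 z + f2 z) - of_real s * (g1 z + g2 z)) \<le> (C1 + C2) * s\<^sup>2" .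
  qed (use C1(3) C2(3) in \<open>auto intro!: continuous_intros C1(1,2) C2(1,2)\<close>)
qed

lemma flow_deriv_sum:
  assumes "\<And>i. i \<in> I \<Longrightarrow> flow_deriv H (f i) (g i)"
  shows "flow_deriv H (\<lambda>z. \<Sum>i\<in>I. f i z) (\<lambda>z. \<Sum>i\<in>I. g i z)"
  using assms
  by (induction I rule: infinite_finite_induct) (auto intro: flow_deriv_const flow_deriv_add)

text \<open>Leibniz rule with remainders. The error term keeps \<open>f2\<close> at the moved point,
  and the hypotheses on \<open>H\<close> keep that point on the sphere, where \<open>f2\<close> is
  bounded.\<close>

lemma flow_deriv_mult:
  assumes H: "adj H = - H" "H ** H ** H = - H"
    and "flow_deriv H f1 g1" "flow_deriv H f2 g2"
  shows "flow_deriv H (\<lambda>z. f1 z * f2 z) (\<lambda>z. g1 z * f2 z + f1 z * g2 z)"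
proof -
  obtain C1 where C1: "continuous_on (sphere 0 1) f1" "continuous_on (sphere 0 1) g1" "0 \<le> C1"
    "\<And>s z. 0 \<le> s \<Longrightarrow> s \<le> 1 \<Longrightarrow> z \<in> sphere 0 1 \<Longrightarrow>
        cmod (f1 (skew_unitary H s *v z) - f1 z - of_real s * g1 z) \<le> C1 * s\<^sup>2"
    using assms(3) by (rule flow_derivE) blast
  obtain C2 where C2: "continuous_on (sphere 0 1) f2" "continuous_on (sphere 0 1) g2" "0 \<le> C2"
    "\<And>s z. 0 \<le> s \<Longrightarrow> s \<le> 1 \<Longrightarrow> z \<in> sphere 0 1 \<Longrightarrow>
        cmod (f2 (skew_unitary H s *v z) - f2 z - of_real s * g2 z) \<le> C2 * s\<^sup>2"
    using assms(4) by (rule flow_derivE) blast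
  obtain B1 where B1: "0 \<le> B1" "\<And>z. z \<in> sphere 0 1 \<Longrightarrow> cmod (f1 z) \<le> B1"
    using C1(1) by (rule sphere_bounded_continuous) blast
  obtain B2 where B2: "0 \<le> B2" "\<And>z. z \<in> sphere 0 1 \<Longrightarrow> cmod (f2 z) \<le> B2"
    using C2(1) by (rule sphere_bounded_continuous) blast
  obtain D1 where D1: "0 \<le> D1" "\<And>z. z \<in> sphere 0 1 \<Longrightarrow> cmod (g1 z) \<le> D1"
    using C1(2) by (rule sphere_bounded_continuous) blast
  obtain D2 where D2: "0 \<le> D2" "\<And>z. z \<in> sphere 0 1 \<Longrightarrow> cmod (g2 z) \<le> D2"
    using C2(2) by (rule sphere_bounded_continuous) blast
  show ?thesis
  proof (rule flow_derivI[where C = "B1 * C2 + D1 * D2 + D1 * C2 + C1 * B2"])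
    fix s :: real and z :: "complex^'a" assume s: "0 \<le> s" "s \<le> 1" and z: "z \<in> sphere 0 1"
    define y where "y = skew_unitary H s *v z"
    have y: "y \<in> sphere 0 1"
      using z norm_unitary[OF unitary_skew_unitary[OF H s], of z] by (simp add: y_def)
    define r1 where "r1 = f1 y - f1 z - of_real s * g1 z"
    define r2 where "r2 = f2 y - f2 z - of_real s * g2 z"
    have r1: "cmod r1 \<le> C1 * s\<^sup>2" using C1(4)[OF s z] by (simp add: r1_def y_def)
    have r2: "cmod r2 \<le> C2 * s\<^sup>2" using C2(4)[OF s z] by (simp add: r2_def y_def)
    have "f1 y * f2 y - f1 z * f2 z - of_real s * (g1 z * f2 z + f1 z * g2 z)
       = f1 z * r2 + of_real (s\<^sup>2) * (g1 z * g2 z) + of_real s * (g1 z * r2) + r1 * f2 y"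
      by (simp add: r1_def r2_def algebra_simps power2_eq_square)
    also have "cmod \<dots> \<le> B1 * (C2 * s\<^sup>2) + s\<^sup>2 * (D1 * D2) + 1 * (D1 * (C2 * s\<^sup>2)) + C1 * s\<^sup>2 * B2"
    proof (intro norm_triangle_mono)
      show "cmod (f1 z * r2) \<le> B1 * (C2 * s\<^sup>2)"
        unfolding norm_mult using B1 r2 z by (intro mult_mono) auto
      show "cmod (of_real (s\<^sup>2) * (g1 z * g2 z)) \<le> s\<^sup>2 * (D1 * D2)"
        unfolding norm_mult using D1 D2 z by (intro mult_mono) (auto simp: norm_power)
      show "cmod (of_real s * (g1 z * r2)) \<le> 1 * (D1 * (C2 * s\<^sup>2))"
        unfolding norm_mult using D1 r2 z s C2(3) by (intro mult_mono) auto
      show "cmod (r1 * f2 y) \<le> C1 * s\<^sup>2 * B2"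
        unfolding norm_mult using B2 r1 y C1(3) by (intro mult_mono) auto
    qed
    finally show "cmod (f1 (skew_unitary H s *v z) * f2 (skew_unitary H s *v z) - f1 z * f2 z
        - of_real s * (g1 z * f2 z + f1 z * g2 z)) \<le> (B1 * C2 + D1 * D2 + D1 * C2 + C1 * B2) * s\<^sup>2"
      by (simp add: y_def algebra_simps)
  qed (use B1(1) C1(3) C2(3) D1(1) D2(1) B2(1) in \<open>auto intro!: continuous_intros C1(1,2) C2(1,2) add_nonneg_nonneg mult_nonneg_nonneg\<close>)
qed

text \<open>By invariance \<open>f\<close> has the same mean after the move, so \<open>s\<close>
  times the mean of \<open>g\<close> is minus the mean of the remainder, of size at most
  \<open>C s^2\<close>. Dividing by \<open>s\<close> and letting \<open>s\<close> tend to 0 gives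
  the claim.\<close>

lemma integral_flow_deriv_eq_0:
  assumes H: "adj H = - H" "H ** H ** H = - H" and "flow_deriv H f g"
  shows "(LINT z|sphere_measure. g z) = 0"
proof -
  obtain C where C: "continuous_on (sphere 0 1) f" "continuous_on (sphere 0 1) g" "0 \<le> C"
    "\<And>s z. 0 \<le> s \<Longrightarrow> s \<le> 1 \<Longrightarrow> z \<in> sphere 0 1 \<Longrightarrow>
        cmod (f (skew_unitary H s *v z) - f z - of_real s * g z) \<le> C * s\<^sup>2"
    using assms(3) by (rule flow_derivE) blast
  have le: "cmod (LINT z|sphere_measure. g z) \<le> C * s" if s: "0 < s" "s \<le> 1" for s
  proof -
    let ?U = "skew_unitary H s"
    have U: "unitary_matrix ?U" using H s by (intro unitary_skew_unitary) auto
    have cU: "continuous_on (sphere 0 1) (\<lambda>z. f (?U *v z))"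
      by (rule continuous_on_compose2[OF C(1)]) (auto intro!: continuous_intros simp: norm_unitary[OF U])
    have cr: "continuous_on (sphere 0 1) (\<lambda>z. f (?U *v z) - f z - of_real s * g z)"
      by (intro continuous_intros cU C)
    have "(LINT z|sphere_measure. f (?U *v z) - f z - of_real s * g z)
      = (LINT z|sphere_measure. f (?U *v z)) - (LINT z|sphere_measure. f z) - of_real s * (LINT z|sphere_measure. g z)"
      by (simp add: sphere_integrable_continuous C cU)
    also have "(LINT z|sphere_measure. f (?U *v z)) = (LINT z|sphere_measure. f z)"
      by (intro integral_sphere_measure_orthogonal orthogonal_transformation_unitary U sphere_measurable_continuous C)
    finally have "s * cmod (LINT z|sphere_measure. g z)
      = cmod (LINT z|sphere_measure. f (?U *v z) - f z - of_real s * g z)"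
      using s by (simp add: norm_mult)
    also have "\<dots> \<le> (LINT z|sphere_measure. cmod (f (?U *v z) - f z - of_real s * g z))"
      by (rule integral_norm_bound)
    also have "\<dots> \<le> (LINT z|(sphere_measure :: (complex^'a) measure). C * s\<^sup>2)"
      using s C(4) by (intro integral_mono sphere_integrable_continuous continuous_intros cr) auto
    also have "\<dots> = s * (C * s)"
      by (simp add: measure_sphere_measure_total power2_eq_square)
    finally show ?thesis using s by simp
  qed
  have "cmod (LINT z|sphere_measure. g z) \<le> 0"
  proof (rule field_le_epsilon)
    fix e :: real assume e: "0 < e"
    \<comment> \<open>The minimum keeps \<open>s\<close> in the range of the error bound;
      \<open>C + 1\<close> avoids dividing by zero.\<close>
    define s where "s = min 1 (e / (C + 1))"
    have "cmod (LINT z|sphere_measure. g z) \<le> C * s"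
      using e C(3) by (intro le) (auto simp: s_def)
    also have "\<dots> \<le> (C + 1) * (e / (C + 1))"
      using e C(3) by (intro mult_mono) (auto simp: s_def)
    also have "\<dots> = e" using C(3) by simp
    finally show "cmod (LINT z|sphere_measure. g z) \<le> 0 + e" by simp
  qed
  then show ?thesis by simp
qed

section \<open>Quadratic forms, commutators and matrix units\<close>

lemma quadratic_form_add: "quadratic_form (A + B) z = quadratic_form A z + quadratic_form B z"
  by (simp add: quadratic_form_def matrix_vector_mult_add_rdistrib hinner_add_left)

lemma quadratic_form_diff: "quadratic_form (A - B) z = quadratic_form A z - quadratic_form B z"
  by (simp add: quadratic_form_def matrix_vector_mult_diff_rdistrib hinner_diff_left)

lemma mat_mult_vec: "mat c *v x = c *s (x :: complex^'n)"
  by (simp add: matrix_vector_mult_def mat_def vec_eq_iff if_distrib[of "\<lambda>u. u * _"] cong: if_cong)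

lemma quadratic_form_mat_mult: "quadratic_form (mat c ** A) z = c * quadratic_form A z"
  by (simp add: quadratic_form_def mat_mult_vec hinner_scale_left flip: matrix_vector_mul_assoc)

lemma quadratic_form_mat: "z \<in> sphere 0 1 \<Longrightarrow> quadratic_form (mat c) z = c"
  by (simp add: quadratic_form_def mat_mult_vec hinner_scale_left hinner_self)

lemma quadratic_form_adj: "quadratic_form (adj A) z = cnj (quadratic_form A z)"
  unfolding quadratic_form_def hinner_adj[of "adj A"] adj_adj by (rule hinner_commute)

lemma mat_mult_commute: "A ** mat c = mat c ** (A :: complex^'n^'n)"
  by (simp add: matrix_matrix_mult_def mat_def vec_eq_iff if_distrib if_distribR mult.commute cong: if_cong)

text \<open>Differentiating both arguments of the form gives \<open><B H z, z> + <B z, H z>\<close>,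
  and skewness moves \<open>H\<close> across the second product with a minus sign.\<close>

lemma flow_deriv_quadratic_form:
  assumes H: "adj H = - H" "H ** H ** H = - H"
  shows "flow_deriv H (quadratic_form B) (quadratic_form (B ** H - H ** B))"
proof -
  \<comment> \<open>The form is expanded into monomials so that the sum and product rules apply; the
    summand with factor 0 is the derivative of the constant coefficient.\<close>
  have "flow_deriv H (\<lambda>z. \<Sum>i\<in>UNIV. \<Sum>j\<in>UNIV. B $ i $ j * (z $ j * cnj (z $ i)))
    (\<lambda>z. \<Sum>i\<in>UNIV. \<Sum>j\<in>UNIV. 0 * (z $ j * cnj (z $ i))
       + B $ i $ j * ((H *v z) $ j * cnj (z $ i) + z $ j * cnj ((H *v z) $ i)))"
    by (intro flow_deriv_sum flow_deriv_mult H flow_deriv_const flow_deriv_cnj flow_deriv_coordinate)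
  moreover have "(\<lambda>z. \<Sum>i\<in>UNIV. \<Sum>j\<in>UNIV. B $ i $ j * (z $ j * cnj (z $ i))) = quadratic_form B"
    by (simp add: fun_eq_iff quadratic_form_def hinner_def matrix_vector_mult_def sum_distrib_right mult.assoc)
  moreover have "(\<Sum>i\<in>UNIV. \<Sum>j\<in>UNIV. 0 * (z $ j * cnj (z $ i))
       + B $ i $ j * ((H *v z) $ j * cnj (z $ i) + z $ j * cnj ((H *v z) $ i)))
     = quadratic_form (B ** H - H ** B) z" for z
  proof -
    have "(\<Sum>i\<in>UNIV. \<Sum>j\<in>UNIV. 0 * (z $ j * cnj (z $ i))
       + B $ i $ j * ((H *v z) $ j * cnj (z $ i) + z $ j * cnj ((H *v z) $ i)))
      = hinner (B *v (H *v z)) z + hinner (B *v z) (H *v z)"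
      unfolding hinner_def matrix_vector_mult_def[of B]
      by (simp add: distrib_left sum.distrib sum_distrib_right mult.assoc)
    also have "hinner (B *v z) (H *v z) = - hinner (H *v (B *v z)) z"
    proof -
      have "hinner (H *v (B *v z)) z = hinner (B *v z) ((- H) *v z)"
        by (simp add: hinner_adj[of H] H)
      also have "(- H) *v z = - (H *v z)"
        by (rule uminus_matrix_vector)
      finally show ?thesis by simp
    qed
    finally show ?thesis
      by (simp add: quadratic_form_diff) (simp add: quadratic_form_def matrix_vector_mul_assoc)
  qed
  ultimately show ?thesis by simp
qed

definition moment4 :: "complex^'n^'n \<Rightarrow> complex^'n^'n \<Rightarrow> complex^'n^'n \<Rightarrow> complex^'n^'n \<Rightarrow> complex" where
  "moment4 A B C D = (LINT z|sphere_measure. quadratic_form A z * quadratic_form B z * quadratic_form C z * quadratic_form D z)"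

text \<open>The Leibniz rule for the derivation in direction \<open>X\<close>. It makes sense, and
  is complex linear in \<open>X\<close>, even where \<open>X\<close> is not tangent to the unitary
  group.\<close>

definition commutator_sum :: "complex^'n^'n \<Rightarrow> complex^'n^'n \<Rightarrow> complex^'n^'n \<Rightarrow> complex^'n^'n \<Rightarrow> complex^'n^'n
    \<Rightarrow> complex^'n \<Rightarrow> complex" where
  "commutator_sum A B C D X z =
     quadratic_form (A ** X - X ** A) z * quadratic_form B z * quadratic_form C z * quadratic_form D z
   + quadratic_form A z * quadratic_form (B ** X - X ** B) z * quadratic_form C z * quadratic_form D z
   + quadratic_form A z * quadratic_form B z * quadratic_form (C ** X - X ** C) z * quadratic_form D z
   + quadratic_form A z * quadratic_form B z * quadratic_form C z * quadratic_form (D ** X - X ** D) z"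

lemma continuous_on_commutator_sum [continuous_intros]:
  "continuous_on S (commutator_sum A B C D X)"
  unfolding commutator_sum_def[abs_def] by (intro continuous_intros)

lemma integral_commutator_sum_skew:
  assumes H: "adj H = - H" "H ** H ** H = - H"
  shows "(LINT z|sphere_measure. commutator_sum A B C D H z) = 0"
proof (rule integral_flow_deriv_eq_0[OF H])
  have "flow_deriv H (\<lambda>z. quadratic_form A z * quadratic_form B z * quadratic_form C z * quadratic_form D z)
     (\<lambda>z. ((quadratic_form (A ** H - H ** A) z * quadratic_form B z
           + quadratic_form A z * quadratic_form (B ** H - H ** B) z) * quadratic_form C z
        + quadratic_form A z * quadratic_form B z * quadratic_form (C ** H - H ** C) z) * quadratic_form D z
        + quadratic_form A z * quadratic_form B z * quadratic_form C z * quadratic_form (D ** H - H ** D) z)"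
    by (intro flow_deriv_mult H flow_deriv_quadratic_form)
  then show "flow_deriv H (\<lambda>z. quadratic_form A z * quadratic_form B z * quadratic_form C z * quadratic_form D z)
     (commutator_sum A B C D H)"
    by (simp only: commutator_sum_def[abs_def] distrib_right)
qed

definition matrix_unit :: "'n \<Rightarrow> 'n \<Rightarrow> complex^'n^'n" where
  "matrix_unit p q = (\<chi> i j. if i = p \<and> j = q then 1 else 0)"

lemma adj_matrix_unit: "adj (matrix_unit p q) = matrix_unit q p"
  by (auto simp: adj_def matrix_unit_def vec_eq_iff)

lemma matrix_unit_vec: "matrix_unit p q *v z = (z $ q) *s axis p 1"
proof -
  have "(\<Sum>j\<in>UNIV. (if i = p \<and> j = q then 1 else 0) * z $ j) = (if i = p then z $ q else 0)" for i
    by (cases "i = p") (simp_all add: if_distrib[of "\<lambda>u. u * _"] cong: if_cong)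
  then show ?thesis
    by (simp add: vec_eq_iff matrix_vector_mult_def matrix_unit_def axis_def)
qed

lemma mat_mult_matrix: "mat c ** A = (\<chi> i j. c * A $ i $ j)"
  by (simp add: matrix_matrix_mult_def mat_def vec_eq_iff if_distrib if_distribR cong: if_cong)

lemma adj_mat_mult: "adj (mat c ** A) = mat (cnj c) ** adj A"
  by (simp add: mat_mult_matrix adj_def vec_eq_iff)

lemma mat_minus_mult: "mat (- c) ** A = - (mat c ** (A :: complex^'n^'n))"
  by (simp add: mat_mult_matrix vec_eq_iff)

lemma commutator_sum_diff: "commutator_sum A B C D (X - Y) z = commutator_sum A B C D X z - commutator_sum A B C D Y z"
  unfolding commutator_sum_def matrix_diff_ldistrib matrix_diff_rdistrib quadratic_form_diff
  by (simp add: algebra_simps)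

lemma commutator_sum_mat_mult: "commutator_sum A B C D (mat c ** X) z = c * commutator_sum A B C D X z"
proof -
  have "A ** (mat c ** X) = mat c ** (A ** X)" for A :: "complex^'a^'a"
    by (simp only: matrix_mul_assoc mat_mult_commute)
  moreover have "(mat c ** X) ** A = mat c ** (X ** A)" for A :: "complex^'a^'a"
    by (rule matrix_mul_assoc[symmetric])
  ultimately show ?thesis
    by (simp only: commutator_sum_def quadratic_form_diff quadratic_form_mat_mult) (simp add: algebra_simps)
qed

text \<open>Matrix units are complex combinations of skew-Hermitian matrices with
  \<open>H^3 = -H\<close>: \<open>i E_pp\<close> on the diagonal, and \<open>E_pq - E_qp\<close>
  together with \<open>i (E_pq + E_qp)\<close> off it.\<close>

lemma integral_commutator_sum_matrix_unit:
  "(LINT z|sphere_measure. commutator_sum A B C D (matrix_unit p q) z) = 0"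
proof (cases "p = q")
  case True
  \<comment> \<open>The diagonal is separate: for \<open>p = q\<close> the two-term matrix used
    below is 0 when \<open>c = 1\<close>, and has eigenvalue \<open>2 i\<close> when
    \<open>c = i\<close>, which violates \<open>H^3 = -H\<close>.\<close>
  define H where "H = mat \<i> ** matrix_unit p p"
  have "adj H = - H"
    by (simp add: H_def adj_mat_mult adj_matrix_unit mat_minus_mult)
  moreover have "H ** H ** H = - H"
  proof -
    have v: "H *v z = (\<i> * z $ p) *s axis p 1" for z
      by (simp add: H_def mat_mult_vec matrix_unit_vec flip: matrix_vector_mul_assoc)
    have "H *v (H *v (H *v z)) = - (H *v z)" for z
      unfolding v by (simp add: vec_eq_iff axis_def)
    then show ?thesis
      by (simp add: matrix_eq uminus_matrix_vector del: minus_diff_eq flip: matrix_vector_mul_assoc)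
  qed
  ultimately have "(LINT z|sphere_measure. commutator_sum A B C D H z) = 0"
    by (intro integral_commutator_sum_skew) simp_all
  then show ?thesis
    by (simp add: H_def commutator_sum_mat_mult True)
next
  case False
  have skew: "(LINT z|sphere_measure. commutator_sum A B C D
      (mat c ** matrix_unit p q - mat (cnj c) ** matrix_unit q p) z) = 0" if c: "c * cnj c = 1" for c
  proof (rule integral_commutator_sum_skew)
    let ?H = "mat c ** matrix_unit p q - mat (cnj c) ** matrix_unit q p"
    show "adj ?H = - ?H"
      by (simp add: adj_diff adj_mat_mult adj_matrix_unit)
    have v: "?H *v z = (c * z $ q) *s axis p 1 - (cnj c * z $ p) *s axis q 1" for z
      by (simp add: matrix_vector_mult_diff_rdistrib mat_mult_vec matrix_unit_vec flip: matrix_vector_mul_assoc)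
    have "?H *v (?H *v (?H *v z)) = - (?H *v z)" for z
      using False c unfolding v
      by (auto simp: vec_eq_iff axis_def algebra_simps)
    then show "?H ** ?H ** ?H = - ?H"
      by (simp add: matrix_eq uminus_matrix_vector del: minus_diff_eq flip: matrix_vector_mul_assoc)
  qed
  have int: "integrable sphere_measure (commutator_sum A B C D X)" for X
    by (intro sphere_integrable_continuous continuous_intros)
  have "c * (LINT z|sphere_measure. commutator_sum A B C D (matrix_unit p q) z)
      - cnj c * (LINT z|sphere_measure. commutator_sum A B C D (matrix_unit q p) z) = 0" if "c * cnj c = 1" for c
    using skew[OF that] by (simp add: commutator_sum_diff commutator_sum_mat_mult int)
  \<comment> \<open>The difference and the sum of the integrals for \<open>E_pq\<close> and
    \<open>E_qp\<close> both vanish.\<close>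
  from this[of 1] this[of \<i>] show ?thesis by simp
qed

lemma sum_hinner_axis: "(\<Sum>q\<in>UNIV. v $ q * hinner (A *v axis q 1) z) = hinner (A *v v) z"
proof -
  have "(\<Sum>q\<in>UNIV. v $ q * hinner (A *v axis q 1) z) = (\<Sum>q\<in>UNIV. \<Sum>i\<in>UNIV. A $ i $ q * v $ q * cnj (z $ i))"
    by (simp add: hinner_def matrix_vector_mult_def axis_def if_distrib[of "\<lambda>u. _ * u"] sum_distrib_left mult_ac
        cong: if_cong)
  also have "\<dots> = hinner (A *v v) z"
    by (subst sum.swap) (simp add: hinner_def matrix_vector_mult_def sum_distrib_right)
  finally show ?thesis .
qed

text \<open>Origin of \<open>n + 3\<close>: in the first slot the commutators sum to
  \<open>n A - tr(A) I\<close>, and each of the other three slots contributes one copy of the full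
  product minus a term with \<open>A\<close> multiplied into that slot.\<close>

lemma commutator_sum_matrix_unit_sum:
  fixes A :: "complex^'n^'n"
  assumes z: "z \<in> sphere 0 1"
  shows "(\<Sum>p\<in>UNIV. \<Sum>q\<in>UNIV. commutator_sum (A ** matrix_unit q p) B C D (matrix_unit p q) z)
    = (of_nat CARD('n) + 3) * (quadratic_form A z * quadratic_form B z * quadratic_form C z * quadratic_form D z)
    - trace A * (quadratic_form B z * quadratic_form C z * quadratic_form D z)
    - quadratic_form (A ** B) z * quadratic_form C z * quadratic_form D z
    - quadratic_form B z * quadratic_form (A ** C) z * quadratic_form D z
    - quadratic_form B z * quadratic_form C z * quadratic_form (A ** D) z"
proof -
  let ?ca = "\<lambda>p q. quadratic_form (A ** matrix_unit q p ** matrix_unit p q - matrix_unit p q ** (A ** matrix_unit q p)) z"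
  let ?cb = "\<lambda>B p q. quadratic_form (A ** matrix_unit q p) z * quadratic_form (B ** matrix_unit p q - matrix_unit p q ** B) z"
  have zz: "hinner z z = 1" using z by (simp add: hinner_self)
  have axis: "hinner (axis p 1) z = cnj (z $ p)" for p
    by (simp add: hinner_def axis_def if_distrib[of "\<lambda>u. u * _"] cong: if_cong)
  have "?ca p q = z $ q * hinner (A *v axis q 1) z - A $ q $ q * (z $ p * cnj (z $ p))" for p q
    by (simp add: quadratic_form_def matrix_vector_mult_diff_rdistrib hinner_diff_left matrix_unit_vec
        vector_scalar_commute hinner_scale_left axis flip: matrix_vector_mul_assoc)
      (simp add: matrix_vector_mult_def axis_def if_distrib[of "\<lambda>u. _ * u"] cong: if_cong)
  then have a: "(\<Sum>p\<in>UNIV. \<Sum>q\<in>UNIV. ?ca p q) = of_nat CARD('n) * quadratic_form A z - trace A"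
    using zz by (simp add: sum_subtractf sum_hinner_axis quadratic_form_def hinner_def[of z z] trace_def
        flip: sum_distrib_left sum_distrib_right)
  have b: "(\<Sum>p\<in>UNIV. \<Sum>q\<in>UNIV. ?cb B p q) = quadratic_form A z * quadratic_form B z - quadratic_form (A ** B) z" for B
  proof -
    have "?cb B p q = (z $ p * hinner (B *v axis p 1) z) * (z $ q * hinner (A *v axis q 1) z)
       - (z $ p * cnj (z $ p)) * ((B *v z) $ q * hinner (A *v axis q 1) z)" for p q
      by (simp add: quadratic_form_def matrix_vector_mult_diff_rdistrib hinner_diff_left matrix_unit_vec
        vector_scalar_commute hinner_scale_left axis algebra_simps flip: matrix_vector_mul_assoc)
    then have "(\<Sum>p\<in>UNIV. \<Sum>q\<in>UNIV. ?cb B p q)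
      = hinner (B *v z) z * hinner (A *v z) z - hinner z z * hinner (A *v (B *v z)) z"
      by (simp add: sum_subtractf hinner_def[of z z] sum_hinner_axis flip: sum_distrib_left sum_distrib_right)
    then show ?thesis
      by (simp add: zz quadratic_form_def mult.commute flip: matrix_vector_mul_assoc)
  qed
  have "commutator_sum (A ** matrix_unit q p) B C D (matrix_unit p q) z
      = ?ca p q * (quadratic_form B z * quadratic_form C z * quadratic_form D z)
      + ?cb B p q * (quadratic_form C z * quadratic_form D z)
      + ?cb C p q * (quadratic_form B z * quadratic_form D z)
      + ?cb D p q * (quadratic_form B z * quadratic_form C z)" for p q
    by (simp add: commutator_sum_def mult_ac)
  then have "(\<Sum>p\<in>UNIV. \<Sum>q\<in>UNIV. commutator_sum (A ** matrix_unit q p) B C D (matrix_unit p q) z)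
      = (\<Sum>p\<in>UNIV. \<Sum>q\<in>UNIV. ?ca p q) * (quadratic_form B z * quadratic_form C z * quadratic_form D z)
      + (\<Sum>p\<in>UNIV. \<Sum>q\<in>UNIV. ?cb B p q) * (quadratic_form C z * quadratic_form D z)
      + (\<Sum>p\<in>UNIV. \<Sum>q\<in>UNIV. ?cb C p q) * (quadratic_form B z * quadratic_form D z)
      + (\<Sum>p\<in>UNIV. \<Sum>q\<in>UNIV. ?cb D p q) * (quadratic_form B z * quadratic_form C z)"
    by (simp only: sum.distrib sum_distrib_right)
  then show ?thesis
    unfolding a b by (simp add: algebra_simps)
qed

text \<open>
  The commutator identity for \<open>A ** matrix_unit q p\<close> and \<open>matrix_unit p q\<close>, summed over all \<open>p\<close> and \<open>q\<close>.
  Slots filled with \<open>mat 1\<close> integrate to moments of lower order.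
\<close>
lemma moment4_recursion:
  fixes A :: "complex^'n^'n"
  shows "(of_nat CARD('n) + 3) * moment4 A B C D
    = trace A * moment4 (mat 1) B C D + moment4 (mat 1) (A ** B) C D + moment4 (mat 1) B (A ** C) D
    + moment4 (mat 1) B C (A ** D)"
proof -
  have int: "integrable sphere_measure (\<lambda>z. quadratic_form A z * quadratic_form B z * quadratic_form C z * quadratic_form D z)"
    for A B C D :: "complex^'n^'n"
    by (intro sphere_integrable_continuous continuous_intros)
  have "0 = (LINT z|sphere_measure. (\<Sum>p\<in>UNIV. \<Sum>q\<in>UNIV. commutator_sum (A ** matrix_unit q p) B C D (matrix_unit p q) z))"
    by (simp add: Bochner_Integration.integral_sum sphere_integrable_continuous continuous_intros
        integral_commutator_sum_matrix_unit)
  also have "\<dots> = (LINT z|sphere_measure.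
      (of_nat CARD('n) + 3) * (quadratic_form A z * quadratic_form B z * quadratic_form C z * quadratic_form D z)
    - trace A * (quadratic_form (mat 1) z * quadratic_form B z * quadratic_form C z * quadratic_form D z)
    - quadratic_form (mat 1) z * quadratic_form (A ** B) z * quadratic_form C z * quadratic_form D z
    - quadratic_form (mat 1) z * quadratic_form B z * quadratic_form (A ** C) z * quadratic_form D z
    - quadratic_form (mat 1) z * quadratic_form B z * quadratic_form C z * quadratic_form (A ** D) z)"
    by (rule Bochner_Integration.integral_cong)
      (simp_all add: commutator_sum_matrix_unit_sum quadratic_form_mat)
  also have "\<dots> = (of_nat CARD('n) + 3) * moment4 A B C D
     - trace A * moment4 (mat 1) B C D - moment4 (mat 1) (A ** B) C D - moment4 (mat 1) B (A ** C) D
    - moment4 (mat 1) B C (A ** D)"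
    by (simp add: int moment4_def)
  finally show ?thesis by (simp add: algebra_simps)
qed

text \<open>\<open>trace2\<close> and \<open>trace3\<close> sum, over all permutations of their
  arguments, the product of the traces along the cycles. The recursive form either gives the new
  matrix its own cycle or inserts it in front of an old one, exactly as the moment recursion
  does.\<close>

definition trace2 :: "complex^'n^'n \<Rightarrow> complex^'n^'n \<Rightarrow> complex" where
  "trace2 C D = trace C * trace D + trace (C ** D)"

definition trace3 :: "complex^'n^'n \<Rightarrow> complex^'n^'n \<Rightarrow> complex^'n^'n \<Rightarrow> complex" where
  "trace3 B C D = trace B * trace2 C D + trace2 (B ** C) D + trace2 C (B ** D)"

text \<open>Each identity matrix among the last three slots makes the recursion reproduce its own
  left-hand side once, which lowers \<open>n + 3\<close> to \<open>n + 2\<close>,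
  \<open>n + 1\<close> and finally \<open>n\<close>.\<close>

lemma moment4_mat_1:
  fixes A :: "complex^'n^'n"
  shows "moment4 (mat 1) (mat 1) (mat 1) (mat 1 :: complex^'n^'n) = 1"
    and "of_nat CARD('n) * moment4 (mat 1) (mat 1) (mat 1) A = trace A"
    and "of_nat (CARD('n) * (CARD('n) + 1)) * moment4 (mat 1) (mat 1) A B = trace2 A B"
    and "of_nat (CARD('n) * (CARD('n) + 1) * (CARD('n) + 2)) * moment4 (mat 1) A B C = trace3 A B C"
proof -
  let ?I = "mat 1 :: complex^'n^'n"
  show 0: "moment4 ?I ?I ?I ?I = 1"
  proof -
    have "moment4 ?I ?I ?I ?I = (LINT z|(sphere_measure :: (complex^'n) measure). 1)"
      unfolding moment4_def by (rule Bochner_Integration.integral_cong) (simp_all add: quadratic_form_mat)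
    then show ?thesis by (simp add: measure_sphere_measure_total)
  qed
  show 1: "of_nat CARD('n) * moment4 ?I ?I ?I A = trace A" for A
  proof -
    have "moment4 A ?I ?I ?I = moment4 ?I ?I ?I A" "moment4 ?I A ?I ?I = moment4 ?I ?I ?I A" "moment4 ?I ?I A ?I = moment4 ?I ?I ?I A"
      by (simp_all add: moment4_def mult_ac)
    then show ?thesis
      using moment4_recursion[of A ?I ?I ?I] 0 by (simp add: distrib_right)
  qed
  show 2: "of_nat (CARD('n) * (CARD('n) + 1)) * moment4 ?I ?I A B = trace2 A B" for A B
  proof -
    have "moment4 A ?I ?I B = moment4 ?I ?I A B" "moment4 ?I A ?I B = moment4 ?I ?I A B"
      by (simp_all add: moment4_def mult_ac)
    then have "(of_nat CARD('n) + 1) * moment4 ?I ?I A B = trace A * moment4 ?I ?I ?I B + moment4 ?I ?I ?I (A ** B)"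
      using moment4_recursion[of A ?I ?I B] by (simp add: algebra_simps)
    then have "of_nat CARD('n) * ((of_nat CARD('n) + 1) * moment4 ?I ?I A B)
       = trace A * (of_nat CARD('n) * moment4 ?I ?I ?I B) + of_nat CARD('n) * moment4 ?I ?I ?I (A ** B)"
      by (simp add: algebra_simps)
    then show ?thesis unfolding 1 by (simp add: trace2_def algebra_simps)
  qed
  show "of_nat (CARD('n) * (CARD('n) + 1) * (CARD('n) + 2)) * moment4 ?I A B C = trace3 A B C" for A B C
  proof -
    have "moment4 A ?I B C = moment4 ?I A B C"
      by (simp_all add: moment4_def mult_ac)
    then have "(of_nat CARD('n) + 2) * moment4 ?I A B C = trace A * moment4 ?I ?I B C
        + moment4 ?I ?I (A ** B) C + moment4 ?I ?I B (A ** C)"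
      using moment4_recursion[of A ?I B C] by (simp add: algebra_simps)
    then have "of_nat (CARD('n) * (CARD('n) + 1)) * ((of_nat CARD('n) + 2) * moment4 ?I A B C)
       = trace A * (of_nat (CARD('n) * (CARD('n) + 1)) * moment4 ?I ?I B C)
        + of_nat (CARD('n) * (CARD('n) + 1)) * moment4 ?I ?I (A ** B) C
        + of_nat (CARD('n) * (CARD('n) + 1)) * moment4 ?I ?I B (A ** C)"
      by (simp only: distrib_left mult.assoc mult.left_commute)
    then show ?thesis unfolding 2 trace3_def by (simp add: algebra_simps)
  qed
qed

lemma moment4_trace:
  fixes A :: "complex^'n^'n"
  shows "of_nat (CARD('n) * (CARD('n) + 1) * (CARD('n) + 2)) * (of_nat CARD('n) + 3) * moment4 A B C D
    = trace A * trace3 B C D + trace3 (A ** B) C D + trace3 B (A ** C) D + trace3 B C (A ** D)"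
proof -
  have "of_nat (CARD('n) * (CARD('n) + 1) * (CARD('n) + 2)) * (of_nat CARD('n) + 3) * moment4 A B C D
    = trace A * (of_nat (CARD('n) * (CARD('n) + 1) * (CARD('n) + 2)) * moment4 (mat 1) B C D)
    + of_nat (CARD('n) * (CARD('n) + 1) * (CARD('n) + 2)) * moment4 (mat 1) (A ** B) C D
    + of_nat (CARD('n) * (CARD('n) + 1) * (CARD('n) + 2)) * moment4 (mat 1) B (A ** C) D
    + of_nat (CARD('n) * (CARD('n) + 1) * (CARD('n) + 2)) * moment4 (mat 1) B C (A ** D)"
    unfolding mult.assoc[of "of_nat (CARD('n) * (CARD('n) + 1) * (CARD('n) + 2))"] moment4_recursion[of A]
    by (simp only: distrib_left mult.assoc mult.left_commute)
  then show ?thesis unfolding moment4_mat_1 .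
qed

section \<open>The norm \<open>\<Psi>\<^sub>0\<close>\<close>

lemma Lp_norm_4: "Lp_norm 4 f ^ 4 = (LINT z|sphere_measure. cmod (f z) ^ 4)"
  by (simp add: Lp_norm_def power4_powr_quarter)

lemma Lp_norm_2: "Lp_norm 2 f ^ 2 = (LINT z|sphere_measure. cmod (f z) ^ 2)"
  by (simp add: Lp_norm_def powr_half_sqrt)

lemma d_coeff_pos: "0 < n \<Longrightarrow> 0 < d_coeff n"
  unfolding d_coeff_def of_nat_0_less_iff by simp

lemma Psi0_nonneg: "0 \<le> Psi0 f"
  by (simp add: Psi0_def)

lemma Psi0_power4:
  fixes f :: "complex^'n \<Rightarrow> complex"
  shows "Psi0 f ^ 4 = 3 * d_coeff CARD('n) * (LINT z|sphere_measure. cmod (f z) ^ 4)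
     + real CARD('n) * d_coeff CARD('n) * (LINT z|sphere_measure. cmod (centered f z) ^ 4)
     + (2 * real CARD('n) * (real CARD('n) + 1) * (LINT z|sphere_measure. cmod (centered f z) ^ 2))\<^sup>2"
proof -
  have d: "0 < d_coeff CARD('n)" by (simp add: d_coeff_pos)
  have "Psi f ^ 4 = 3 * d_coeff CARD('n) * (LINT z|sphere_measure. cmod (f z) ^ 4)
     + real CARD('n) * d_coeff CARD('n) * (LINT z|sphere_measure. cmod (centered f z) ^ 4)"
    unfolding Psi_def using d by (subst power4_powr_quarter) (simp_all add: Lp_norm_4)
  moreover have "Psi3 g ^ 4 = (2 * real CARD('n) * (real CARD('n) + 1) * (LINT z|sphere_measure. cmod (g z) ^ 2))\<^sup>2"
    for g :: "complex^'n \<Rightarrow> complex"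
  proof -
    have "Psi3 g ^ 4 = ((Psi3 g)\<^sup>2)\<^sup>2" by simp
    also have "(Psi3 g)\<^sup>2 = 2 * real CARD('n) * (real CARD('n) + 1) * (LINT z|sphere_measure. cmod (g z) ^ 2)"
      by (simp add: Psi3_def power_mult_distrib Lp_norm_2)
    finally show ?thesis .
  qed
  moreover have "Psi0 f ^ 4 = Psi f ^ 4 + Psi3 (centered f) ^ 4"
    unfolding Psi0_def by (rule power4_powr_quarter) simp
  ultimately show ?thesis by simp
qed

lemma continuous_on_centered [continuous_intros]:
  "continuous_on S f \<Longrightarrow> continuous_on S (centered f)"
  unfolding centered_def by (intro continuous_intros)

section \<open>Norm axioms and unitary invariance of \<open>Psi0\<close>\<close>

lemma centered_add:
  fixes f g :: "complex^'n \<Rightarrow> complex"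
  assumes "continuous_on (sphere 0 1) f" "continuous_on (sphere 0 1) g"
  shows "centered (\<lambda>z. f z + g z) z = centered f z + centered g z"
  using assms by (simp add: centered_def sphere_integrable_continuous)

lemma centered_cmult: "centered (\<lambda>z. c * f z) z = c * centered f z"
  by (simp add: centered_def right_diff_distrib)

lemma centered_unitary:
  assumes "continuous_on (sphere 0 1) f" "unitary_matrix U"
  shows "centered (\<lambda>z. f (U *v z)) z = centered f (U *v z)"
  using integral_sphere_measure_orthogonal[OF orthogonal_transformation_unitary[OF assms(2)]
      sphere_measurable_continuous[OF assms(1)]]
  by (simp add: centered_def)

text \<open>Convexity of the square at the points \<open>x / a\<close> and \<open>y / b\<close> with
  weights proportional to \<open>a\<close> and \<open>b\<close>.\<close>

lemma square_sum_le_weighted: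
  fixes x y a b :: real
  assumes "0 < a" "0 < b"
  shows "(x + y)\<^sup>2 \<le> (a + b) * (x\<^sup>2 / a + y\<^sup>2 / b)"
proof -
  have "(a + b) * (x\<^sup>2 / a + y\<^sup>2 / b) - (x + y)\<^sup>2 = (b * x - a * y)\<^sup>2 / (a * b)"
    using assms by (simp add: field_simps power2_eq_square)
  also have "\<dots> \<ge> 0" using assms by simp
  finally show ?thesis by simp
qed

text \<open>A second application of the same convexity. It lifts the estimate from squares to fourth
  powers, and it also handles the \<open>Psi3\<close> term, which is the square of a second
  moment.\<close>

lemma square_weighted_le:
  fixes p q a b :: real
  assumes "0 < a" "0 < b"
  shows "((a + b) * (p / a + q / b))\<^sup>2 \<le> (a + b) ^ 3 * (p\<^sup>2 / a ^ 3 + q\<^sup>2 / b ^ 3)"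
proof -
  have "(p / a + q / b)\<^sup>2 \<le> (a + b) * ((p / a)\<^sup>2 / a + (q / b)\<^sup>2 / b)"
    using assms by (rule square_sum_le_weighted)
  then have "(a + b)\<^sup>2 * (p / a + q / b)\<^sup>2 \<le> (a + b)\<^sup>2 * ((a + b) * ((p / a)\<^sup>2 / a + (q / b)\<^sup>2 / b))"
    by (intro mult_left_mono) auto
  also have "\<dots> = (a + b) ^ 3 * (p\<^sup>2 / a ^ 3 + q\<^sup>2 / b ^ 3)"
    by (simp add: power_divide power2_eq_square power3_eq_cube mult.assoc)
  finally show ?thesis by (simp only: power_mult_distrib)
qed

lemma power4_sum_le_weighted:
  fixes x y a b :: real
  assumes "0 < a" "0 < b"
  shows "(x + y) ^ 4 \<le> (a + b) ^ 3 * (x ^ 4 / a ^ 3 + y ^ 4 / b ^ 3)"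
proof -
  have "((x + y)\<^sup>2)\<^sup>2 \<le> ((a + b) * (x\<^sup>2 / a + y\<^sup>2 / b))\<^sup>2"
    using square_sum_le_weighted[OF assms] by (intro power_mono) auto
  also have "\<dots> \<le> (a + b) ^ 3 * ((x\<^sup>2)\<^sup>2 / a ^ 3 + (y\<^sup>2)\<^sup>2 / b ^ 3)"
    using assms by (rule square_weighted_le)
  finally show ?thesis by simp
qed

lemma integral_power4_sum_le:
  fixes f g :: "complex^'n \<Rightarrow> complex"
  assumes f: "continuous_on (sphere 0 1) f" and g: "continuous_on (sphere 0 1) g" and ab: "0 < a" "0 < b"
  shows "(LINT z|sphere_measure. cmod (f z + g z) ^ 4)
    \<le> (a + b) ^ 3 * ((LINT z|sphere_measure. cmod (f z) ^ 4) / a ^ 3 + (LINT z|sphere_measure. cmod (g z) ^ 4) / b ^ 3)"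
proof -
  have "(LINT z|sphere_measure. cmod (f z + g z) ^ 4)
     \<le> (LINT z|sphere_measure. (a + b) ^ 3 * (cmod (f z) ^ 4 / a ^ 3 + cmod (g z) ^ 4 / b ^ 3))"
  proof (rule integral_mono)
    fix z
    have "cmod (f z + g z) ^ 4 \<le> (cmod (f z) + cmod (g z)) ^ 4"
      by (intro power_mono norm_triangle_ineq) auto
    also have "\<dots> \<le> (a + b) ^ 3 * (cmod (f z) ^ 4 / a ^ 3 + cmod (g z) ^ 4 / b ^ 3)"
      using ab by (rule power4_sum_le_weighted)
    finally show "cmod (f z + g z) ^ 4 \<le> (a + b) ^ 3 * (cmod (f z) ^ 4 / a ^ 3 + cmod (g z) ^ 4 / b ^ 3)" .
  qed (use ab in \<open>intro sphere_integrable_continuous continuous_intros f g; simp\<close>)+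
  also have "\<dots> = (a + b) ^ 3 * ((LINT z|sphere_measure. cmod (f z) ^ 4) / a ^ 3 + (LINT z|sphere_measure. cmod (g z) ^ 4) / b ^ 3)"
    by (simp add: sphere_integrable_continuous continuous_intros f g)
  finally show ?thesis .
qed

lemma integral_power2_sum_le:
  fixes f g :: "complex^'n \<Rightarrow> complex"
  assumes f: "continuous_on (sphere 0 1) f" and g: "continuous_on (sphere 0 1) g" and ab: "0 < a" "0 < b"
  shows "(LINT z|sphere_measure. cmod (f z + g z) ^ 2)
    \<le> (a + b) * ((LINT z|sphere_measure. cmod (f z) ^ 2) / a + (LINT z|sphere_measure. cmod (g z) ^ 2) / b)"
proof -
  have "(LINT z|sphere_measure. cmod (f z + g z) ^ 2)
     \<le> (LINT z|sphere_measure. (a + b) * (cmod (f z) ^ 2 / a + cmod (g z) ^ 2 / b))"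
  proof (rule integral_mono)
    fix z
    have "cmod (f z + g z) ^ 2 \<le> (cmod (f z) + cmod (g z)) ^ 2"
      by (intro power_mono norm_triangle_ineq) auto
    also have "\<dots> \<le> (a + b) * (cmod (f z) ^ 2 / a + cmod (g z) ^ 2 / b)"
      using ab by (rule square_sum_le_weighted)
    finally show "cmod (f z + g z) ^ 2 \<le> (a + b) * (cmod (f z) ^ 2 / a + cmod (g z) ^ 2 / b)" .
  qed (use ab in \<open>intro sphere_integrable_continuous continuous_intros f g; simp\<close>)+
  also have "\<dots> = (a + b) * ((LINT z|sphere_measure. cmod (f z) ^ 2) / a + (LINT z|sphere_measure. cmod (g z) ^ 2) / b)"
    by (simp add: sphere_integrable_continuous continuous_intros f g)
  finally show ?thesis .
qed

text \<open>
  Convexity of the 4-homogeneous functional \<open>Psi0 ^ 4\<close>, rescaled so that letting \<open>a\<close> and \<open>b\<close> tend to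
  \<open>Psi0 f\<close> and \<open>Psi0 g\<close> yields the triangle inequality.
\<close>
lemma Psi0_sum_power4_le:
  fixes f g :: "complex^'n \<Rightarrow> complex"
  assumes f: "continuous_on (sphere 0 1) f" and g: "continuous_on (sphere 0 1) g" and ab: "0 < a" "0 < b"
  shows "Psi0 (\<lambda>z. f z + g z) ^ 4 \<le> (a + b) ^ 3 * (Psi0 f ^ 4 / a ^ 3 + Psi0 g ^ 4 / b ^ 3)"
proof -
  let ?n = "real CARD('n)"
  let ?I = "\<lambda>k f. LINT z|sphere_measure. cmod (f z) ^ k"
  have d: "0 \<le> d_coeff CARD('n)" by (simp add: d_coeff_def)
  have cf: "continuous_on (sphere 0 1) (centered f)" and cg: "continuous_on (sphere 0 1) (centered g)"
    by (intro continuous_intros f g)+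
  have c: "centered (\<lambda>z. f z + g z) = (\<lambda>z. centered f z + centered g z)"
    using centered_add[OF f g] by auto
  define s where "s = 2 * ?n * (?n + 1)"
  have s: "0 \<le> s" by (simp add: s_def)
  have "s * ?I 2 (\<lambda>z. centered f z + centered g z) \<le> s * ((a + b) * (?I 2 (centered f) / a + ?I 2 (centered g) / b))"
    using s by (intro mult_left_mono integral_power2_sum_le cf cg ab)
  also have "\<dots> = (a + b) * (s * ?I 2 (centered f) / a + s * ?I 2 (centered g) / b)"
    by (simp add: algebra_simps)
  finally have "(s * ?I 2 (\<lambda>z. centered f z + centered g z))\<^sup>2
     \<le> ((a + b) * (s * ?I 2 (centered f) / a + s * ?I 2 (centered g) / b))\<^sup>2"
    using s by (intro power_mono) auto
  also have "\<dots> \<le> (a + b) ^ 3 * ((s * ?I 2 (centered f))\<^sup>2 / a ^ 3 + (s * ?I 2 (centered g))\<^sup>2 / b ^ 3)"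
    using ab by (rule square_weighted_le)
  finally have 3: "(s * ?I 2 (\<lambda>z. centered f z + centered g z))\<^sup>2
     \<le> (a + b) ^ 3 * ((s * ?I 2 (centered f))\<^sup>2 / a ^ 3 + (s * ?I 2 (centered g))\<^sup>2 / b ^ 3)" .
  have 1: "3 * d_coeff CARD('n) * ?I 4 (\<lambda>z. f z + g z)
     \<le> 3 * d_coeff CARD('n) * ((a + b) ^ 3 * (?I 4 f / a ^ 3 + ?I 4 g / b ^ 3))"
    using d by (intro mult_left_mono integral_power4_sum_le f g ab) auto
  have 2: "?n * d_coeff CARD('n) * ?I 4 (\<lambda>z. centered f z + centered g z)
     \<le> ?n * d_coeff CARD('n) * ((a + b) ^ 3 * (?I 4 (centered f) / a ^ 3 + ?I 4 (centered g) / b ^ 3))"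
    using d by (intro mult_left_mono integral_power4_sum_le cf cg ab) auto
  have "Psi0 (\<lambda>z. f z + g z) ^ 4
     \<le> 3 * d_coeff CARD('n) * ((a + b) ^ 3 * (?I 4 f / a ^ 3 + ?I 4 g / b ^ 3))
     + ?n * d_coeff CARD('n) * ((a + b) ^ 3 * (?I 4 (centered f) / a ^ 3 + ?I 4 (centered g) / b ^ 3))
     + (a + b) ^ 3 * ((s * ?I 2 (centered f))\<^sup>2 / a ^ 3 + (s * ?I 2 (centered g))\<^sup>2 / b ^ 3)"
    unfolding Psi0_power4 c s_def[symmetric] by (intro add_mono 1 2 3)
  also have "\<dots> = (a + b) ^ 3 * (Psi0 f ^ 4 / a ^ 3 + Psi0 g ^ 4 / b ^ 3)"
    unfolding Psi0_power4 s_def[symmetric] by (simp only: add_divide_distrib distrib_left times_divide_eq_right mult_ac add_ac)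
  finally show ?thesis .
qed

lemma Psi0_triangle:
  fixes f g :: "complex^'n \<Rightarrow> complex"
  assumes f: "continuous_on (sphere 0 1) f" and g: "continuous_on (sphere 0 1) g"
  shows "Psi0 (\<lambda>z. f z + g z) \<le> Psi0 f + Psi0 g"
proof (rule field_le_epsilon)
  fix e :: real assume e: "0 < e"
  \<comment> \<open>The added \<open>e / 2\<close> keeps both weights positive even if one of the
    norms is zero. Since each norm is at most its weight, \<open>N ^ 4 / c ^ 3 \<le> c\<close>
    collapses the convexity bound to \<open>(a + b) ^ 4\<close>.\<close>
  define a b where "a = Psi0 f + e / 2" and "b = Psi0 g + e / 2"
  have ab: "0 < a" "0 < b" using e Psi0_nonneg[of f] Psi0_nonneg[of g] by (simp_all add: a_def b_def)
  have le: "N ^ 4 / c ^ 3 \<le> c" if "0 \<le> N" "N \<le> c" "0 < c" for N c :: real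
  proof -
    have "N ^ 4 \<le> c ^ 4" using that by (intro power_mono)
    also have "c ^ 4 = c * c ^ 3" by (simp add: power_numeral_reduce)
    finally show ?thesis using that by (simp add: divide_le_eq)
  qed
  have "Psi0 (\<lambda>z. f z + g z) ^ 4 \<le> (a + b) ^ 3 * (Psi0 f ^ 4 / a ^ 3 + Psi0 g ^ 4 / b ^ 3)"
    using f g ab by (rule Psi0_sum_power4_le)
  also have "\<dots> \<le> (a + b) ^ 3 * (a + b)"
    using ab e by (intro mult_left_mono add_mono le Psi0_nonneg) (simp_all add: a_def b_def)
  also have "\<dots> = (a + b) ^ 4" by (simp add: power_numeral_reduce mult.commute)
  finally have "Psi0 (\<lambda>z. f z + g z) \<le> a + b"
    by (rule power_mono_iff[THEN iffD1, rotated 3]) (use ab Psi0_nonneg in auto)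
  then show "Psi0 (\<lambda>z. f z + g z) \<le> Psi0 f + Psi0 g + e" by (simp add: a_def b_def)
qed

lemma Psi0_cmult: "Psi0 (\<lambda>z. c * f z) = cmod c * Psi0 f"
proof -
  have "Psi0 (\<lambda>z. c * f z) ^ 4 = (cmod c * Psi0 f) ^ 4"
  proof -
    have c: "centered (\<lambda>z. c * f z) = (\<lambda>z. c * centered f z)"
      using centered_cmult[of c f] by auto
    show ?thesis
      unfolding power_mult_distrib Psi0_power4 c
      by (simp add: norm_mult power_mult_distrib distrib_left)
  qed
  then show ?thesis
    by (rule power_eq_imp_eq_base) (auto simp: Psi0_nonneg)
qed

lemma Psi0_eq_0_iff:
  fixes f :: "complex^'n \<Rightarrow> complex"
  assumes f: "continuous_on (sphere 0 1) f"
  shows "Psi0 f = 0 \<longleftrightarrow> (\<forall>z\<in>sphere 0 1. f z = 0)"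
proof
  assume "Psi0 f = 0"
  then have "Psi0 f ^ 4 = 0" by simp
  moreover have "0 < d_coeff CARD('n)" by (simp add: d_coeff_pos)
  moreover have "0 \<le> (LINT z|sphere_measure. cmod (f z) ^ 4)" "0 \<le> (LINT z|sphere_measure. cmod (centered f z) ^ 4)"
    by simp_all
  \<comment> \<open>All three summands of the fourth power are nonnegative; the uncentred one alone
    already detects \<open>f\<close>, since centring kills constants.\<close>
  ultimately have "3 * d_coeff CARD('n) * (LINT z|sphere_measure. cmod (f z) ^ 4) = 0"
    unfolding Psi0_power4
    by (metis (no_types, lifting) add_nonneg_eq_0_iff add_nonneg_nonneg mult_nonneg_nonneg of_nat_0_le_iff
       less_imp_le zero_le_numeral zero_le_power2)
  then have "(LINT z|sphere_measure. cmod (f z) ^ 4) = 0"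
    using \<open>0 < d_coeff CARD('n)\<close> by simp
  then have "cmod (f z) ^ 4 = 0" if "z \<in> sphere 0 1" for z
    by (rule sphere_integral_eq_0_imp[rotated 2]) (use that in \<open>auto intro!: continuous_intros f\<close>)
  then show "\<forall>z\<in>sphere 0 1. f z = 0" by simp
next
  assume 0: "\<forall>z\<in>sphere 0 1. f z = 0"
  have I: "(LINT z|sphere_measure. h z) = 0" if "\<forall>z\<in>sphere 0 1. h z = 0"
    for h :: "complex^'n \<Rightarrow> 'b::{banach, second_countable_topology}"
  proof -
    have "(LINT z|sphere_measure. h z) = (LINT z|(sphere_measure :: (complex^'n) measure). 0)"
      using that by (intro Bochner_Integration.integral_cong) auto
    then show ?thesis by simp
  qed
  have "\<forall>z\<in>sphere 0 1. centered f z = 0"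
    using 0 I[OF 0] by (simp add: centered_def)
  then have "Psi0 f ^ 4 = 0"
    unfolding Psi0_power4 using 0 by (simp add: I)
  then show "Psi0 f = 0" by simp
qed

lemma Psi0_unitary:
  assumes f: "continuous_on (sphere 0 1) f" and U: "unitary_matrix U"
  shows "Psi0 (\<lambda>z. f (U *v z)) = Psi0 f"
proof -
  have I: "(LINT z|sphere_measure. cmod (g (U *v z)) ^ k) = (LINT z|sphere_measure. cmod (g z) ^ k)"
    if "continuous_on (sphere 0 1) g" for g k
    by (intro integral_sphere_measure_orthogonal orthogonal_transformation_unitary U
        sphere_measurable_continuous continuous_intros that)
  have "centered (\<lambda>z. f (U *v z)) = (\<lambda>z. centered f (U *v z))"
    using centered_unitary[OF f U] by auto
  then have "Psi0 (\<lambda>z. f (U *v z)) ^ 4 = Psi0 f ^ 4"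
    unfolding Psi0_power4 by (simp only: I f continuous_on_centered)
  then show ?thesis
    by (rule power_eq_imp_eq_base) (auto simp: Psi0_nonneg)
qed

lemma unitarily_invariant_norm_Psi0: "unitarily_invariant_norm (Psi0 :: (complex^'n \<Rightarrow> complex) \<Rightarrow> real)"
  unfolding unitarily_invariant_norm_def
  by (simp add: Psi0_nonneg Psi0_eq_0_iff Psi0_cmult Psi0_triangle Psi0_unitary)

section \<open>The trace formula\<close>

lemma trace_mat: "trace (mat c :: complex^'n^'n) = of_nat CARD('n) * c"
  by (simp add: trace_def mat_def)

lemma trace_mat_mult: "trace (mat c ** A) = c * trace A"
  by (simp add: trace_def mat_mult_matrix sum_distrib_left)

lemma trace_adj: "trace (adj A) = cnj (trace A)"
  by (simp add: trace_def adj_def)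

lemma mat_mult_mat: "mat c ** mat d = (mat (c * d) :: complex^'n^'n)"
  unfolding mat_mult_matrix by (simp add: mat_def vec_eq_iff)

text \<open>The trace polynomial whose terms are indexed by the cycle types of the permutations of
  the word \<open>A A C C\<close>.\<close>
definition trace4 :: "complex^'n^'n \<Rightarrow> complex^'n^'n \<Rightarrow> complex" where
  "trace4 A C = trace A ^ 2 * trace C ^ 2 + trace (A ** A) * trace C ^ 2 + trace (C ** C) * trace A ^ 2
    + 4 * trace (A ** C) * trace A * trace C + trace (A ** A) * trace (C ** C) + 2 * trace (A ** C) ^ 2
    + 4 * trace (A ** A ** C) * trace C + 4 * trace (A ** C ** C) * trace A
    + 4 * trace (A ** A ** C ** C) + 2 * trace (A ** C ** A ** C)"

text \<open>With two equal pairs of arguments, cyclicity of the trace merges the 24 products indexed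
  by permutations into ten kinds; the coefficients of \<open>trace4\<close> add up to 24.\<close>

lemma moment4_trace4:
  fixes A :: "complex^'n^'n"
  shows "of_nat (CARD('n) * (CARD('n) + 1) * (CARD('n) + 2)) * (of_nat CARD('n) + 3) * moment4 A A C C = trace4 A C"
proof -
  have t2: "trace (C ** A) = trace (A ** C)" by (rule trace_mul_sym)
  have t3: "trace (A ** C ** A) = trace (A ** A ** C)" "trace (C ** A ** A) = trace (A ** A ** C)"
    "trace (C ** C ** A) = trace (A ** C ** C)" "trace (C ** A ** C) = trace (A ** C ** C)"
    using trace_mul_sym[of A "A ** C"] trace_mul_sym[of C "A ** A"] trace_mul_sym[of "C ** C" A] trace_mul_sym[of C "A ** C"]
    by (simp_all add: matrix_mul_assoc)
  have t4: "trace (A ** C ** C ** A) = trace (A ** A ** C ** C)" "trace (C ** C ** A ** A) = trace (A ** A ** C ** C)"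
    "trace (C ** A ** A ** C) = trace (A ** A ** C ** C)" "trace (C ** A ** C ** A) = trace (A ** C ** A ** C)"
    using trace_mul_sym[of A "A ** C ** C"] trace_mul_sym[of "C ** C" "A ** A"]  trace_mul_sym[of C "A ** A ** C"]
     trace_mul_sym[of C "A ** C ** A"]
    by (simp_all add: matrix_mul_assoc)
  show ?thesis
    unfolding moment4_trace trace3_def trace2_def trace4_def
    by (simp add: matrix_mul_assoc t2 t3 t4 algebra_simps power2_eq_square)
qed

text \<open>Scalar matrices are central, so every word expands binomially, and terms containing a
  single \<open>B\<close> or a single \<open>C\<close> and nothing else vanish because these are
  traceless.\<close>

lemma trace_shift:
  fixes B C :: "complex^'n^'n" and a b :: complex
  assumes tr: "trace B = 0" "trace C = 0"
  defines "A \<equiv> B + mat a" and "D \<equiv> C + mat b" and "n \<equiv> of_nat CARD('n)"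
  shows "trace A = n * a" "trace D = n * b"
    "trace (A ** A) = trace (B ** B) + n * a\<^sup>2"
    "trace (D ** D) = trace (C ** C) + n * b\<^sup>2"
    "trace (A ** D) = trace (B ** C) + n * (a * b)"
    "trace (A ** A ** D) = trace (B ** B ** C) + b * trace (B ** B) + 2 * a * trace (B ** C) + n * (a\<^sup>2 * b)"
    "trace (A ** D ** D) = trace (B ** C ** C) + a * trace (C ** C) + 2 * b * trace (B ** C) + n * (a * b\<^sup>2)"
    "trace (A ** A ** D ** D) = trace (B ** B ** C ** C) + 2 * b * trace (B ** B ** C) + 2 * a * trace (B ** C ** C)
       + b\<^sup>2 * trace (B ** B) + a\<^sup>2 * trace (C ** C) + 4 * (a * b) * trace (B ** C) + n * (a\<^sup>2 * b\<^sup>2)"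
    "trace (A ** D ** A ** D) = trace (B ** C ** B ** C) + 2 * b * trace (B ** B ** C) + 2 * a * trace (B ** C ** C)
       + b\<^sup>2 * trace (B ** B) + a\<^sup>2 * trace (C ** C) + 4 * (a * b) * trace (B ** C) + n * (a\<^sup>2 * b\<^sup>2)"
proof -
  have pull': "X ** (mat c ** Y) = mat c ** (X ** Y)" for X Y :: "complex^'n^'n" and c
    by (simp only: matrix_mul_assoc mat_mult_commute[of X])
  have mat2: "mat c ** (mat d ** Y) = mat (c * d) ** Y" for Y :: "complex^'n^'n" and c d
    by (simp only: matrix_mul_assoc mat_mult_mat)
  \<comment> \<open>Oriented rules that carry all scalar matrices to the front of a right-nested
    word and merge them there.\<close>
  note pull = mat_mult_commute[of B] mat_mult_commute[of C] pull'[of B] pull'[of C] mat2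
  have t2: "trace (C ** B) = trace (B ** C)" by (rule trace_mul_sym)
  have t3: "trace (B ** (C ** B)) = trace (B ** (B ** C))" "trace (C ** (B ** B)) = trace (B ** (B ** C))"
    "trace (C ** (C ** B)) = trace (B ** (C ** C))" "trace (C ** (B ** C)) = trace (B ** (C ** C))"
    using trace_mul_sym[of B "B ** C"] trace_mul_sym[of C "B ** B"] trace_mul_sym[of "C ** C" B] trace_mul_sym[of C "B ** C"]
    by (simp_all flip: matrix_mul_assoc)
  note expand = matrix_add_ldistrib matrix_add_rdistrib pull mat_mult_mat trace_add trace_mat_mult trace_mat tr t2 t3
  show "trace A = n * a" "trace D = n * b"
    by (simp_all add: A_def D_def n_def expand)
  show "trace (A ** A) = trace (B ** B) + n * a\<^sup>2" "trace (D ** D) = trace (C ** C) + n * b\<^sup>2"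
    "trace (A ** D) = trace (B ** C) + n * (a * b)"
    unfolding A_def D_def n_def power2_eq_square
    by (simp_all only: expand) (simp_all add: algebra_simps)
  show "trace (A ** A ** D) = trace (B ** B ** C) + b * trace (B ** B) + 2 * a * trace (B ** C) + n * (a\<^sup>2 * b)"
    "trace (A ** D ** D) = trace (B ** C ** C) + a * trace (C ** C) + 2 * b * trace (B ** C) + n * (a * b\<^sup>2)"
    unfolding A_def D_def n_def power2_eq_square
    by (simp_all only: expand flip: matrix_mul_assoc) (simp_all add: algebra_simps)
  show "trace (A ** A ** D ** D) = trace (B ** B ** C ** C) + 2 * b * trace (B ** B ** C) + 2 * a * trace (B ** C ** C)
       + b\<^sup>2 * trace (B ** B) + a\<^sup>2 * trace (C ** C) + 4 * (a * b) * trace (B ** C) + n * (a\<^sup>2 * b\<^sup>2)"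
    "trace (A ** D ** A ** D) = trace (B ** C ** B ** C) + 2 * b * trace (B ** B ** C) + 2 * a * trace (B ** C ** C)
       + b\<^sup>2 * trace (B ** B) + a\<^sup>2 * trace (C ** C) + 4 * (a * b) * trace (B ** C) + n * (a\<^sup>2 * b\<^sup>2)"
    unfolding A_def D_def n_def power2_eq_square
    by (simp_all only: expand flip: matrix_mul_assoc) (simp_all add: algebra_simps)
qed

text \<open>Comparing coefficients explains the constants. \<open>(tr(B C))^2\<close> has
  coefficient \<open>2 (n + 3)\<close> from the two \<open>trace4\<close> terms and
  \<open>4 (n + 3)\<close> from the last one, hence the 6. The coefficient of
  \<open>b^2 tr(B B)\<close> fixes \<open>2 / n\<close>. The case \<open>B = C = 0\<close>, where
  \<open>trace4 A D\<close> equals \<open>n(n+1)(n+2)(n+3) a^2 b^2\<close>, fixes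
  \<open>3 n - 2\<close>.\<close>

lemma trace4_identity:
  fixes B C :: "complex^'n^'n" and a b :: complex
  assumes tr: "trace B = 0" "trace C = 0"
  defines "A \<equiv> B + mat a" and "D \<equiv> C + mat b" and "n \<equiv> of_nat CARD('n)"
  shows "3 * trace4 A D + n * trace4 B C + 4 * (n + 3) * trace (B ** C) ^ 2
    = (n + 3) * (4 * trace (A ** A ** D ** D) + 2 * trace (A ** D ** A ** D) + 6 * trace (A ** D) ^ 2
       + 2 / n * (trace (A ** A) * trace D ^ 2 + trace (D ** D) * trace A ^ 2)
       + trace (A ** A) * trace (D ** D) + (3 * n - 2) / n ^ 2 * (trace A ^ 2 * trace D ^ 2))"
proof -
  have n: "n \<noteq> 0" by (simp add: n_def)
  have 1: "2 / n * (x * (n * b) ^ 2 + y * (n * a) ^ 2) = 2 * n * (x * b ^ 2 + y * a ^ 2)" for x y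
    using n by (simp add: field_simps power2_eq_square)
  have 2: "(3 * n - 2) / n ^ 2 * ((n * a) ^ 2 * (n * b) ^ 2) = (3 * n - 2) * n ^ 2 * (a ^ 2 * b ^ 2)"
    using n by (simp add: field_simps power2_eq_square)
  show ?thesis
    unfolding trace4_def tr A_def D_def trace_shift[OF tr] n_def[symmetric] 1 2
    by (simp add: algebra_simps power2_eq_square)
qed

section \<open>Translation between \<open>Psi0\<close> and the moments\<close>

lemma integral_cmod_power4:
  "complex_of_real (LINT z|sphere_measure. cmod (quadratic_form A z) ^ 4) = moment4 A A (adj A) (adj A)"
proof -
  have "complex_of_real (cmod w ^ 4) = w * w * cnj w * cnj w" for w
  proof -
    have "complex_of_real (cmod w ^ 4) = (complex_of_real ((cmod w)\<^sup>2))\<^sup>2" by simp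
    then show ?thesis
      unfolding complex_norm_square by (simp add: power2_eq_square mult_ac)
  qed
  then show ?thesis
    unfolding moment4_def quadratic_form_adj by (simp only: flip: integral_complex_of_real)
qed

lemma integral_cmod_power2:
  "complex_of_real (LINT z|sphere_measure. cmod (quadratic_form A z) ^ 2) = moment4 (mat 1) (mat 1) A (adj A)"
  unfolding moment4_def integral_complex_of_real[symmetric]
  by (rule Bochner_Integration.integral_cong)
    (simp_all add: quadratic_form_mat quadratic_form_adj complex_norm_square del: of_real_power)

lemma integral_quadratic_form:
  fixes A :: "complex^'n^'n"
  shows "(LINT z|sphere_measure. quadratic_form A z) = trace A / of_nat CARD('n)"
proof -
  have "(LINT z|sphere_measure. quadratic_form A z) = moment4 (mat 1) (mat 1) (mat 1) A"
    unfolding moment4_def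
    by (rule Bochner_Integration.integral_cong) (simp_all add: quadratic_form_mat)
  then show ?thesis
    using moment4_mat_1(2)[of A] by (simp add: field_simps)
qed

lemma centered_quadratic_form:
  fixes A :: "complex^'n^'n"
  assumes "z \<in> sphere 0 1"
  shows "centered (quadratic_form A) z = quadratic_form (A - mat (trace A / of_nat CARD('n))) z"
  using assms by (simp add: centered_def integral_quadratic_form quadratic_form_diff quadratic_form_mat)

text \<open>The constants in the norm clear the moment denominators: \<open>d_n\<close> leaves only
  \<open>n + 3\<close>, and \<open>2 n (n + 1)\<close> turns the second moment into
  \<open>2 tr(B adj B)\<close>, the other summand of \<open>trace2\<close> being killed by
  \<open>tr B = 0\<close>.\<close>

lemma Psi0_quadratic_form_power4:
  fixes A :: "complex^'n^'n"
  defines "B \<equiv> A - mat (trace A / of_nat CARD('n))"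
  shows "(of_nat CARD('n) + 3) * complex_of_real (Psi0 (quadratic_form A) ^ 4)
    = 3 * trace4 A (adj A) + of_nat CARD('n) * trace4 B (adj B)
      + 4 * (of_nat CARD('n) + 3) * trace (B ** adj B) ^ 2"
proof -
  let ?n = "of_nat CARD('n) :: complex"
  let ?d = "of_nat (CARD('n) * (CARD('n) + 1) * (CARD('n) + 2)) :: complex"
  have c: "(LINT z|sphere_measure. cmod (centered (quadratic_form A) z) ^ k)
     = (LINT z|sphere_measure. cmod (quadratic_form B z) ^ k)" for k
    by (rule Bochner_Integration.integral_cong) (simp_all add: centered_quadratic_form B_def)
  have d: "complex_of_real (d_coeff CARD('n)) = ?d"
    unfolding d_coeff_def by (rule of_real_of_nat_eq)
  have trB: "trace B = 0"
    by (simp add: B_def trace_sub trace_mat)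
  have "complex_of_real (Psi0 (quadratic_form A) ^ 4)
     = 3 * ?d * moment4 A A (adj A) (adj A) + ?n * ?d * moment4 B B (adj B) (adj B)
      + (2 * (of_nat (CARD('n) * (CARD('n) + 1)) * moment4 (mat 1) (mat 1) B (adj B)))\<^sup>2"
    unfolding Psi0_power4 c integral_cmod_power4[symmetric] integral_cmod_power2[symmetric] d[symmetric]
    by (simp add: algebra_simps)
  also have "of_nat (CARD('n) * (CARD('n) + 1)) * moment4 (mat 1) (mat 1) B (adj B) = trace (B ** adj B)"
    unfolding moment4_mat_1(3) trace2_def by (simp add: trB)
  finally have "(?n + 3) * complex_of_real (Psi0 (quadratic_form A) ^ 4)
     = 3 * (?d * (?n + 3) * moment4 A A (adj A) (adj A)) + ?n * (?d * (?n + 3) * moment4 B B (adj B) (adj B))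
      + 4 * (?n + 3) * trace (B ** adj B) ^ 2"
    by (simp only: power_mult_distrib distrib_left) (simp add: algebra_simps)
  then show ?thesis
    unfolding moment4_trace4 .
qed

text \<open>The identity is checked over the complex numbers, where \<open>A\<close> and
  \<open>adj A\<close> can be treated as the two independent matrices of
  \<open>trace4_identity\<close>.\<close>

lemma induced_norm_Psi0_power4:
  fixes A :: "complex^'n^'n"
  shows "induced_norm Psi0 A ^ 4 =
        4 * frobenius_norm (A ** A) ^ 2
        + 2 * schatten4_norm A ^ 4
        + 6 * frobenius_norm A ^ 4
        + 4 / real CARD('n) * Re (trace (A ** A) * trace (adj A) ^ 2)
        + cmod (trace (A ** A)) ^ 2
        + (3 * real CARD('n) - 2) / real CARD('n) ^ 2 * cmod (trace A) ^ 4" (is "_ = ?R")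
proof -
  let ?n = "of_nat CARD('n) :: complex"
  define a where "a = trace A / ?n"
  define B where "B = A - mat a"
  have A: "A = B + mat a" "adj A = adj B + mat (cnj a)"
    by (simp_all add: B_def adj_diff adj_mat)
  have trB: "trace B = 0" "trace (adj B) = 0"
    by (simp_all add: B_def a_def trace_sub trace_mat trace_adj)
  have n3: "?n + 3 \<noteq> 0"
    by (metis of_nat_add of_nat_eq_0_iff of_nat_numeral add_is_0 zero_neq_numeral)
  have frob: "complex_of_real (frobenius_norm X ^ 2) = trace (X ** adj X)" for X :: "complex^'n^'n"
    by (simp add: frobenius_norm_def trace_mult_adj sum_nonneg)
  have schatten: "complex_of_real (schatten4_norm A ^ 4) = trace (A ** adj A ** A ** adj A)"
  proof -
    have "trace (A ** adj A ** adj (A ** adj A)) = complex_of_real (frobenius_norm (A ** adj A) ^ 2)"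
      by (simp only: frob)
    then have "trace (A ** adj A ** A ** adj A) = complex_of_real (frobenius_norm (A ** adj A) ^ 2)"
      by (simp only: adj_mult adj_adj matrix_mul_assoc)
    then show ?thesis
      unfolding schatten4_norm_power4 by (simp only: Re_complex_of_real)
  qed
  have "complex_of_real ?R = 4 * trace (A ** A ** adj A ** adj A) + 2 * trace (A ** adj A ** A ** adj A)
     + 6 * trace (A ** adj A) ^ 2
     + 2 / ?n * (trace (A ** A) * trace (adj A) ^ 2 + trace (adj A ** adj A) * trace A ^ 2)
     + trace (A ** A) * trace (adj A ** adj A) + (3 * ?n - 2) / ?n ^ 2 * (trace A ^ 2 * trace (adj A) ^ 2)"
  proof -
    have 1: "complex_of_real (frobenius_norm (A ** A) ^ 2) = trace (A ** A ** adj A ** adj A)"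
      unfolding frob adj_mult matrix_mul_assoc ..
    have 2: "complex_of_real (frobenius_norm A ^ 4) = trace (A ** adj A) ^ 2"
      unfolding frob[symmetric] by simp
    have cnj2: "trace (adj A ** adj A) = cnj (trace (A ** A))"
      by (simp only: adj_mult[symmetric] trace_adj)
    \<comment> \<open>Writing the real part as half the sum with its conjugate turns the coefficient
      \<open>4 / n\<close> into the symmetric \<open>2 / n\<close> of the trace identity.\<close>
    have 3: "complex_of_real (Re (trace (A ** A) * trace (adj A) ^ 2))
       = (trace (A ** A) * trace (adj A) ^ 2 + trace (adj A ** adj A) * trace A ^ 2) / 2"
    proof -
      have Re_eq: "complex_of_real (Re w) = (w + cnj w) / 2" for w
        by (simp add: complex_eq_iff)
      show ?thesis
        unfolding Re_eq cnj2 trace_adj complex_cnj_mult complex_cnj_power complex_cnj_cnj ..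
    qed
    have 4: "complex_of_real (cmod (trace (A ** A)) ^ 2) = trace (A ** A) * trace (adj A ** adj A)"
      unfolding cnj2 by (rule complex_norm_square)
    have 5: "complex_of_real (cmod (trace A) ^ 4) = trace A ^ 2 * trace (adj A) ^ 2"
    proof -
      have "complex_of_real (cmod (trace A) ^ 4) = (complex_of_real (cmod (trace A) ^ 2)) ^ 2" by simp
      then show ?thesis unfolding complex_norm_square trace_adj by (simp only: power_mult_distrib)
    qed
    show ?thesis
      unfolding of_real_add of_real_mult 1 2 3 4 5 schatten by (simp add: field_simps)
  qed
  then have "(?n + 3) * complex_of_real ?R
     = 3 * trace4 A (adj A) + ?n * trace4 B (adj B) + 4 * (?n + 3) * trace (B ** adj B) ^ 2"
    using trace4_identity[OF trB, of a "cnj a"] by (simp only: A[symmetric])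
  also have "\<dots> = (?n + 3) * complex_of_real (induced_norm Psi0 A ^ 4)"
    unfolding induced_norm_def Psi0_quadratic_form_power4 B_def a_def ..
  finally show ?thesis
    using n3 by (simp only: mult_cancel_left of_real_eq_iff simp_thms)
qed

lemma weakly_unitarily_invariant_norm_induced:
  fixes \<Phi> :: "(complex^'n \<Rightarrow> complex) \<Rightarrow> real"
  assumes \<Phi>: "unitarily_invariant_norm \<Phi>"
  shows "weakly_unitarily_invariant_norm (induced_norm \<Phi>)"
  unfolding weakly_unitarily_invariant_norm_def induced_norm_def
proof (intro conjI allI impI)
  have cont: "continuous_on (sphere 0 1) (quadratic_form A)" for A :: "complex^'n^'n"
    by (rule continuous_on_quadratic_form)
  fix A B :: "complex^'n^'n" and c :: complex
  show "0 \<le> \<Phi> (quadratic_form A)"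
    using \<Phi> cont by (simp add: unitarily_invariant_norm_def)
  have "A = 0" if 0: "\<forall>\<xi>\<in>sphere 0 1. quadratic_form A \<xi> = 0"
  proof (rule matrix_zero_if_quadratic_zero)
    fix x :: "complex^'n"
    show "hinner (A *v x) x = 0"
    proof (cases "x = 0")
      case False
      \<comment> \<open>The form is homogeneous, so vanishing on the sphere extends to all vectors
        and polarisation applies.\<close>
      have "x = of_real (norm x) *s (x /\<^sub>R norm x)"
        using False by (simp add: vec_eq_iff scaleR_conv_of_real[where 'a = complex])
      then obtain r where "x = of_real r *s (x /\<^sub>R norm x)" by blast
      moreover have "hinner (A *v (x /\<^sub>R norm x)) (x /\<^sub>R norm x) = 0"
        using 0 False by (simp add: quadratic_form_def)
      moreover have "hinner (A *v (c *s y)) (c *s y) = c * cnj c * hinner (A *v y) y" for c y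
        by (simp add: vector_scalar_commute hinner_scale_left hinner_scale_right)
      ultimately show ?thesis by (metis mult_zero_right)
    qed simp
  qed
  moreover have "\<Phi> (quadratic_form A) = 0 \<longleftrightarrow> (\<forall>\<xi>\<in>sphere 0 1. quadratic_form A \<xi> = 0)"
    using \<Phi> cont by (simp add: unitarily_invariant_norm_def)
  ultimately show "\<Phi> (quadratic_form A) = 0 \<longleftrightarrow> A = 0"
    by (auto simp: quadratic_form_def)
  have "quadratic_form (\<chi> i j. c * A $ i $ j) = (\<lambda>\<xi>. c * quadratic_form A \<xi>)"
    by (simp add: fun_eq_iff quadratic_form_mat_mult flip: mat_mult_matrix)
  then show "\<Phi> (quadratic_form (\<chi> i j. c * A $ i $ j)) = cmod c * \<Phi> (quadratic_form A)"
    using \<Phi> cont by (simp add: unitarily_invariant_norm_def)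
  have "quadratic_form (A + B) = (\<lambda>\<xi>. quadratic_form A \<xi> + quadratic_form B \<xi>)"
    by (simp add: fun_eq_iff quadratic_form_add)
  then show "\<Phi> (quadratic_form (A + B)) \<le> \<Phi> (quadratic_form A) + \<Phi> (quadratic_form B)"
    using \<Phi> cont by (simp add: unitarily_invariant_norm_def)
next
  fix A U :: "complex^'n^'n" assume U: "unitary_matrix U"
  \<comment> \<open>Conjugating the matrix amounts to composing its form with \<open>adj U\<close>,
    so unitary invariance of the norm is applied to \<open>adj U\<close>.\<close>
  have "quadratic_form (U ** A ** adj U) = (\<lambda>\<xi>. quadratic_form A (adj U *v \<xi>))"
    by (simp add: fun_eq_iff quadratic_form_def hinner_adj[of U] flip: matrix_vector_mul_assoc)
  moreover have "\<forall>f U. continuous_on (sphere 0 1) f \<longrightarrow> unitary_matrix U \<longrightarrow> \<Phi> (\<lambda>\<xi>. f (U *v \<xi>)) = \<Phi> f"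
    using \<Phi> unfolding unitarily_invariant_norm_def by (elim conjE)
  note this[rule_format, OF continuous_on_quadratic_form unitary_matrix_adj[OF U]]
  ultimately show "\<Phi> (quadratic_form (U ** A ** adj U)) = \<Phi> (quadratic_form A)"
    by (simp only:)
qed

theorem theorem4p4:
  shows "unitarily_invariant_norm (Psi0 :: (complex^'n \<Rightarrow> complex) \<Rightarrow> real) \<and>
    weakly_unitarily_invariant_norm (induced_norm Psi0 :: complex^'n^'n \<Rightarrow> real) \<and>
    (\<forall>A :: complex^'n^'n.
      induced_norm Psi0 A ^ 4 =
        4 * frobenius_norm (A ** A) ^ 2
        + 2 * schatten4_norm A ^ 4
        + 6 * frobenius_norm A ^ 4
        + 4 / real CARD('n) * Re (trace (A ** A) * trace (adj A) ^ 2)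
        + cmod (trace (A ** A)) ^ 2
        + (3 * real CARD('n) - 2) / real CARD('n) ^ 2 * cmod (trace A) ^ 4)"
  by (intro conjI allI unitarily_invariant_norm_Psi0 weakly_unitarily_invariant_norm_induced
      induced_norm_Psi0_power4)

end
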